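(* There is an absolute constant $c_0\in(0,1)$ such that for every constant $C>0$ and every $\xi\in(0,c_0]$ there is a constant $K>0$ (depending only on $C$ and $\xi$) for which the following holds. For all integers $d\ge 1$, all $\gamma,\alpha\in(0,c_0]$ and all $\epsilon\in(0,C]$, there exists an $\epsilon$-DP $(\gamma,0.9\gamma)$-robust learner in dimension $d$, with accuracy parameter $\alpha$ and failure probability $\xi$, whose sample complexity is at most $$K\,\alpha^{-K}\cdot\frac{1}{\epsilon}\max\left\{d,\frac1{\gamma^2}\right\}.$$
   Context: Let $\mathbb{B}^d=\{\mathbf{x}\in\mathbb{R}^d:\|\mathbf{x}\|_2\le 1\}$. For $\mathbf{w}\in\mathbb{R}^d$ the halfspace $h_{\mathbf{w}}:\mathbb{B}^d\to\{\pm1\}$ is $h_{\mathbf{w}}(\mathbf{x})=\operatorname{sgn}(\langle \mathbf{w},\mathbf{x}\rangle)$, with $\operatorname{sgn}(t)=+1$ for $t\ge 0$ and $-1$ for $t<0$. For $\gamma\ge 0$, a hypothesis $h:\mathbb{B}^d\to\{\pm1\}$ and a distribution $\mathcal{D}$ on $\mathbb{B}^d\times\{\pm1\}$, the robust risk is $\mathcal{R}_\gamma(h,\mathcal{D})=\Pr_{(\mathbf{x},y)\sim\mathcal{D}}[\exists \mathbf{z}\in\mathbb{B}^d:\ \|\mathbf{z}-\mathbf{x}\|_2\le\gamma,\ h(\mathbf{z})\ne y]$. $\mathcal{D}$ is $\gamma$-realizable if there is $\mathbf{w}^*\in\mathbb{R}^d$ with $\mathcal{R}_\gamma(h_{\mathbf{w}^*},\mathcal{D})=0$.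 A learner is a randomized algorithm $\mathbb{A}$ that takes a finite dataset (of any size) of labelled points in $\mathbb{B}^d\times\{\pm1\}$ and outputs a hypothesis $h:\mathbb{B}^d\to\{\pm1\}$. It is a $(\gamma,\gamma')$-robust learner with accuracy $\alpha$, failure probability $\xi$ and sample complexity $n$ if, for every $\gamma$-realizable $\mathcal{D}$, when run on $n$ i.i.d. samples from $\mathcal{D}$ it outputs, with probability at least $1-\xi$, a hypothesis $h$ with $\mathcal{R}_{\gamma'}(h,\mathcal{D})\le\alpha$. Relevant events are assumed measurable. Two datasets are neighbors if one results from the other by adding or removing a single data point. A randomized algorithm $\mathbb{A}$ is $(\epsilon,\delta)$-DP if for all neighboring datasets $\mathbf{X},\mathbf{X}'$ and all sets $S$ of outputs, $\Pr[\mathbb{A}(\mathbf{X})\in S]\le e^{\epsilon}\Pr[\mathbb{A}(\mathbf{X}')\in S]+\delta$; $\epsilon$-DP means $(\epsilon,0)$-DP. *)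

theory Defs
  imports "HOL-Probability.Probability" "HOL-Library.Multiset"
begin

text \<open>
  The dimension \<open>d\<close> is quantified inside the main statement, so vectors of \<open>\<real>\<^sup>d\<close> are functions
  \<open>x :: nat \<Rightarrow> real\<close> with \<open>x \<in> extensional {..<d}\<close>. This set is the space of \<open>\<Pi>\<^sub>M i\<in>{..<d}. borel\<close>,
  whose \<open>\<sigma>\<close>-algebra is the Borel \<open>\<sigma>\<close>-algebra of \<open>\<real>\<^sup>d\<close>. Labels are the integers \<open>1\<close> and \<open>-1\<close>.
\<close>

type_synonym point = "nat \<Rightarrow> real"
type_synonym example = "point \<times> int"
type_synonym hypothesis = "point \<Rightarrow> int"
type_synonym learner = "example multiset \<Rightarrow> hypothesis measure"

definition inner_d :: "nat \<Rightarrow> point \<Rightarrow> point \<Rightarrow> real" where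
  "inner_d d x y = (\<Sum>i<d. x i * y i)"

definition norm_d :: "nat \<Rightarrow> point \<Rightarrow> real" where
  "norm_d d x = L2_set x {..<d}"

definition dist_d :: "nat \<Rightarrow> point \<Rightarrow> point \<Rightarrow> real" where
  "dist_d d x y = L2_set (\<lambda>i. x i - y i) {..<d}"

definition unit_ball :: "nat \<Rightarrow> point set" where
  "unit_ball d = {x \<in> extensional {..<d}. norm_d d x \<le> 1}"

definition labels :: "int set" where
  "labels = {-1, 1}"

definition hypotheses :: "nat \<Rightarrow> hypothesis set" where
  "hypotheses d = (unit_ball d \<rightarrow>\<^sub>E labels)"

text \<open>Unlike the library's \<^const>\<open>sgn\<close>, the sign of \<open>0\<close> is \<open>+1\<close> here.\<close>

definition sign :: "real \<Rightarrow> int" where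
  "sign t = (if t \<ge> 0 then 1 else -1)"

definition halfspace :: "nat \<Rightarrow> point \<Rightarrow> hypothesis" where
  "halfspace d w = restrict (\<lambda>x. sign (inner_d d w x)) (unit_ball d)"

definition example_space :: "nat \<Rightarrow> example measure" where
  "example_space d =
     restrict_space (\<Pi>\<^sub>M i\<in>{..<d}. borel) (unit_ball d) \<Otimes>\<^sub>M count_space labels"

definition example_distribution :: "nat \<Rightarrow> example measure \<Rightarrow> bool" where
  "example_distribution d D \<longleftrightarrow> prob_space D \<and> sets D = sets (example_space d)"

definition robust_error :: "nat \<Rightarrow> real \<Rightarrow> hypothesis \<Rightarrow> example set" where
  "robust_error d \<gamma> h =
     {(x, y) \<in> unit_ball d \<times> labels. \<exists>z\<in>unit_ball d. dist_d d z x \<le> \<gamma> \<and> h z \<noteq> y}"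

text \<open>
  For an arbitrary \<open>h\<close>, \<^term>\<open>robust_error d \<gamma> h\<close> may fail to be measurable, in which case
  \<^const>\<open>measure\<close> returns the default value \<open>0\<close>. The learning guarantee below therefore explicitly
  requires measurability. For halfspaces the set is always Borel.
\<close>

definition robust_risk :: "nat \<Rightarrow> real \<Rightarrow> hypothesis \<Rightarrow> example measure \<Rightarrow> real" where
  "robust_risk d \<gamma> h D = measure D (robust_error d \<gamma> h)"

definition realizable :: "nat \<Rightarrow> real \<Rightarrow> example measure \<Rightarrow> bool" where
  "realizable d \<gamma> D \<longleftrightarrow>
     (\<exists>w\<in>extensional {..<d}. robust_risk d \<gamma> (halfspace d w) D = 0)"

text \<open>Datasets are finite multisets, so neighbours differ by one occurrence of one example.\<close>

definition datasets :: "nat \<Rightarrow> example multiset set" where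
  "datasets d = {X. set_mset X \<subseteq> unit_ball d \<times> labels}"

definition neighbours :: "example multiset \<Rightarrow> example multiset \<Rightarrow> bool" where
  "neighbours X X' \<longleftrightarrow> (\<exists>p. X' = add_mset p X \<or> X = add_mset p X')"

text \<open>
  The output distribution is defined on all sets of hypotheses, so that privacy is required
  of every set of outputs and not just of those in a smaller \<open>\<sigma>\<close>-algebra.
\<close>

definition randomized_algorithm :: "nat \<Rightarrow> learner \<Rightarrow> bool" where
  "randomized_algorithm d A \<longleftrightarrow>
     (\<forall>X\<in>datasets d. prob_space (A X) \<and> sets (A X) = Pow (hypotheses d))"

definition differentially_private :: "nat \<Rightarrow> real \<Rightarrow> real \<Rightarrow> learner \<Rightarrow> bool" where
  "differentially_private d \<epsilon> \<delta> A \<longleftrightarrow>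
     (\<forall>X\<in>datasets d. \<forall>X'\<in>datasets d. neighbours X X' \<longrightarrow>
        (\<forall>S\<subseteq>hypotheses d. measure (A X) S \<le> exp \<epsilon> * measure (A X') S + \<delta>))"

definition run_on_sample :: "nat \<Rightarrow> learner \<Rightarrow> (nat \<Rightarrow> example) \<Rightarrow> hypothesis measure" where
  "run_on_sample n A \<omega> = A (image_mset \<omega> (mset_set {..<n}))"

text \<open>
  Measurability of \<^term>\<open>run_on_sample n A\<close> as a Markov kernel makes the law
  \<^term>\<open>bind (\<Pi>\<^sub>M i\<in>{..<n}. D) (run_on_sample n A)\<close> of the output well defined; the probability is
  jointly over the \<open>n\<close> i.i.d. samples and the randomness of \<open>A\<close>.
\<close>

definition robust_learner ::
    "nat \<Rightarrow> real \<Rightarrow> real \<Rightarrow> real \<Rightarrow> real \<Rightarrow> nat \<Rightarrow> learner \<Rightarrow> bool" where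
  "robust_learner d \<gamma> \<gamma>' \<alpha> \<xi> n A \<longleftrightarrow>
     randomized_algorithm d A \<and>
     run_on_sample n A \<in>
       (\<Pi>\<^sub>M i\<in>{..<n}. example_space d) \<rightarrow>\<^sub>M prob_algebra (count_space (hypotheses d)) \<and>
     (\<forall>D. example_distribution d D \<longrightarrow> realizable d \<gamma> D \<longrightarrow>
        measure (bind (\<Pi>\<^sub>M i\<in>{..<n}. D) (run_on_sample n A))
          {h \<in> hypotheses d. robust_error d \<gamma>' h \<in> sets D \<and> robust_risk d \<gamma>' h D \<le> \<alpha>}
        \<ge> 1 - \<xi>)"

end

theory Submission
  imports Defs
begin

text \<open>
  The learner is the exponential mechanism over the finite class of halfspaces with integer normal
  vectors \<open>v\<close>, \<open>\<parallel>v\<parallel>\<^sup>2 \<le> M\<close>, where \<open>M\<close> is of order \<open>max {d, 1 / \<gamma>\<^sup>2}\<close> up to powers of \<open>1 / \<alpha>\<close>; the score of a halfspace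
  is its number of robust errors. Weighting \<open>v\<close> by \<open>2 ^ (M - \<parallel>v\<parallel>\<^sup>2)\<close> shows that the class has at most
  \<open>2 ^ M * 3 ^ d\<close> members, so no logarithm of \<open>d\<close> or \<open>1 / \<gamma>\<close> is lost.

  The class contains a good halfspace for every \<open>\<gamma>\<close>-realizable distribution: scale the unit normal of
  the target to length \<open>T\<close>, where \<open>T\<close> dominates both \<open>\<surd>d\<close> and \<open>1 / \<gamma>\<close>, and round its coordinates to
  integers. This changes the norm by at most \<open>\<surd>d\<close>, and the rounding can be chosen so that the
  change of \<open>\<langle>v, x\<rangle>\<close> has second moment at most \<open>1\<close> under the distribution; by Chebyshev's
  inequality the margin \<open>T \<gamma>\<close> survives up to a factor close to \<open>1\<close> on almost all of the mass.
\<close>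

section \<open>Robust errors of halfspaces\<close>

lemma norm_d_nonneg [simp]: "0 \<le> norm_d d x"
  by (simp add: norm_d_def)

lemma inner_d_self: "inner_d d x x = (norm_d d x)\<^sup>2"
  by (simp add: inner_d_def norm_d_def L2_set_def sum_nonneg power2_eq_square)

lemma inner_d_le: "\<bar>inner_d d x y\<bar> \<le> norm_d d x * norm_d d y"
proof -
  have "\<bar>inner_d d x y\<bar> \<le> (\<Sum>i<d. \<bar>x i\<bar> * \<bar>y i\<bar>)"
    unfolding inner_d_def by (rule order_trans[OF sum_abs]) (simp add: abs_mult)
  also have "\<dots> \<le> norm_d d x * norm_d d y"
    unfolding norm_d_def by (rule L2_set_mult_ineq)
  finally show ?thesis .
qed

lemma norm_d_scale: "norm_d d (\<lambda>i. c * x i) = \<bar>c\<bar> * norm_d d x"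
proof -
  have "norm_d d (\<lambda>i. c * x i) = sqrt (c\<^sup>2 * (\<Sum>i<d. (x i)\<^sup>2))"
    by (simp add: norm_d_def L2_set_def power_mult_distrib sum_distrib_left)
  also have "\<dots> = \<bar>c\<bar> * norm_d d x"
    by (simp add: norm_d_def L2_set_def real_sqrt_mult)
  finally show ?thesis .
qed

lemma norm_d_add: "norm_d d (\<lambda>i. x i + y i) \<le> norm_d d x + norm_d d y"
  unfolding norm_d_def by (rule L2_set_triangle_ineq)

lemma inner_d_add: "inner_d d w (\<lambda>i. x i + y i) = inner_d d w x + inner_d d w y"
  by (simp add: inner_d_def distrib_left sum.distrib)

lemma inner_d_scale: "inner_d d w (\<lambda>i. c * x i) = c * inner_d d w x"
  by (simp add: inner_d_def sum_distrib_left mult_ac)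

lemma inner_d_add_left: "inner_d d (\<lambda>i. x i + y i) w = inner_d d x w + inner_d d y w"
  by (simp add: inner_d_def distrib_right sum.distrib)

lemma inner_d_scale_left: "inner_d d (\<lambda>i. c * x i) w = c * inner_d d x w"
  by (simp add: inner_d_def sum_distrib_left mult_ac)

lemma inner_d_commute: "inner_d d x y = inner_d d y x"
  by (simp add: inner_d_def mult.commute)

text \<open>Elements of \<open>unit_ball d\<close> are extensional, so constructed points must be
  restricted to \<open>{..<d}\<close>; these rules discard the restriction again.\<close>

lemma restrict_lessThan_d [simp]:
  "norm_d d (restrict x {..<d}) = norm_d d x"
  "dist_d d (restrict x {..<d}) y = dist_d d x y"
  "inner_d d w (restrict x {..<d}) = inner_d d w x"
  by (auto simp: norm_d_def dist_d_def inner_d_def intro!: L2_set_cong)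

lemma unit_ball_abs_le:
  assumes "x \<in> unit_ball d" "i < d"
  shows "\<bar>x i\<bar> \<le> 1"
proof -
  have "(x i)\<^sup>2 \<le> (\<Sum>i<d. (x i)\<^sup>2)"
    using assms by (intro member_le_sum) auto
  also have "\<dots> = (norm_d d x)\<^sup>2"
    by (subst inner_d_self[symmetric]) (simp add: inner_d_def power2_eq_square)
  also have "\<dots> \<le> 1"
    using assms by (simp add: unit_ball_def power_le_one)
  finally show ?thesis by (simp add: abs_square_le_1)
qed

text \<open>
  The point \<open>z\<close> is found by projecting \<open>x\<close> onto the hyperplane orthogonal to \<open>w\<close> and moving from
  the projection towards \<open>- w / \<parallel>w\<parallel>\<close>; both steps stay in the unit ball.
\<close>

lemma exists_close_below:
  assumes x: "x \<in> unit_ball d" and w: "norm_d d w > 0"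
    and a: "0 \<le> inner_d d w x" and r: "0 \<le> r" "r \<le> 1"
  shows "\<exists>z\<in>unit_ball d. dist_d d z x \<le> 2 * r + inner_d d w x / norm_d d w
           \<and> inner_d d w z = - r * norm_d d w"
proof -
  define u where "u = (\<lambda>i. (1 / norm_d d w) * w i)"
  define a' where "a' = inner_d d w x / norm_d d w"
  define p where "p = (\<lambda>i. x i + (- a') * u i)"
  \<comment> \<open>A convex combination of \<open>p\<close> and \<open>- u\<close>, both in the
    unit ball. Leaving \<open>p\<close> costs at most \<open>r * norm_d d p + r\<close>, whence the
    term \<open>2 * r\<close> in the distance.\<close>
  define z where "z = (\<lambda>i. (1 - r) * p i + (- r) * u i)"
  have nu: "norm_d d u = 1"
    unfolding u_def norm_d_scale using w by simp
  have wu: "inner_d d w u = norm_d d w"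
    unfolding u_def inner_d_scale using w by (simp add: inner_d_self power2_eq_square)
  have wp: "inner_d d w p = 0"
    unfolding p_def inner_d_add inner_d_scale wu using w by (simp add: a'_def)
  have xu: "inner_d d u x = a'"
    unfolding u_def inner_d_scale_left by (simp add: a'_def)
  have up: "inner_d d u p = 0"
    unfolding p_def inner_d_add inner_d_scale by (simp add: inner_d_self nu xu)
  \<comment> \<open>Pythagoras: projecting cannot increase the norm, so \<open>p\<close> stays in
    the ball.\<close>
  have "(norm_d d x)\<^sup>2 = (norm_d d p)\<^sup>2 + a'\<^sup>2"
  proof -
    have "x = (\<lambda>i. p i + a' * u i)" by (simp add: p_def)
    then have "inner_d d x x = inner_d d (\<lambda>i. p i + a' * u i) (\<lambda>i. p i + a' * u i)" by simp
    also have "\<dots> = inner_d d p p + 2 * a' * inner_d d u p + a'\<^sup>2 * inner_d d u u"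
      by (simp only: inner_d_add inner_d_add_left inner_d_scale inner_d_scale_left
          inner_d_commute[of d p u]) (simp add: power2_eq_square algebra_simps)
    finally show ?thesis by (simp add: inner_d_self up nu)
  qed
  then have "(norm_d d p)\<^sup>2 \<le> (norm_d d x)\<^sup>2" by simp
  then have np: "norm_d d p \<le> 1"
    using x power2_le_imp_le[of "norm_d d p" "norm_d d x"] by (simp add: unit_ball_def)
  have "norm_d d z \<le> norm_d d (\<lambda>i. (1 - r) * p i) + norm_d d (\<lambda>i. (- r) * u i)"
    unfolding z_def by (rule norm_d_add)
  also have "\<dots> = (1 - r) * norm_d d p + r"
    using r unfolding norm_d_scale nu by simp
  also have "\<dots> \<le> (1 - r) * 1 + r"
    using r np by (intro add_right_mono mult_left_mono) auto
  finally have nz: "norm_d d z \<le> 1" by simp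
  have "dist_d d z x = norm_d d (\<lambda>i. ((- r) * p i + (- r) * u i) + (- a') * u i)"
    unfolding dist_d_def norm_d_def z_def p_def by (intro L2_set_cong) (auto simp: algebra_simps)
  also have "\<dots> \<le> (norm_d d (\<lambda>i. (- r) * p i) + norm_d d (\<lambda>i. (- r) * u i)) + norm_d d (\<lambda>i. (- a') * u i)"
    by (intro order_trans[OF norm_d_add] add_right_mono norm_d_add)
  also have "\<dots> = r * norm_d d p + r + a'"
    using r w a by (simp only: norm_d_scale nu) (simp add: a'_def)
  also have "\<dots> \<le> r * 1 + r + a'"
    using r np by (intro add_right_mono mult_left_mono) auto
  finally have dz: "dist_d d z x \<le> 2 * r + a'" by simp
  have wz: "inner_d d w z = - r * norm_d d w"
    unfolding z_def inner_d_add inner_d_scale wp wu by simp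
  show ?thesis
    using nz dz wz by (intro bexI[of _ "restrict z {..<d}"]) (auto simp: unit_ball_def a'_def)
qed

text \<open>The case of \<open>- w\<close> and \<open>r = 0\<close> above. Reaching the hyperplane
  is enough on this side, since \<open>sign 0\<close> is already \<open>1\<close>.\<close>

lemma exists_close_above:
  assumes x: "x \<in> unit_ball d" and w: "norm_d d w > 0" and a: "inner_d d w x \<le> 0"
  shows "\<exists>z\<in>unit_ball d. dist_d d z x \<le> - inner_d d w x / norm_d d w \<and> inner_d d w z = 0"
proof -
  let ?w = "\<lambda>i. (- 1) * w i"
  have "\<exists>z\<in>unit_ball d. dist_d d z x \<le> 2 * 0 + inner_d d ?w x / norm_d d ?w
          \<and> inner_d d ?w z = - 0 * norm_d d ?w"
    by (rule exists_close_below) (unfold norm_d_scale inner_d_scale_left, use assms in auto)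
  then show ?thesis
    by (simp only: norm_d_scale inner_d_scale_left) simp
qed

lemma inner_d_diff_le: "\<bar>inner_d d w z - inner_d d w x\<bar> \<le> norm_d d w * dist_d d z x"
proof -
  have "inner_d d w z - inner_d d w x = inner_d d w (\<lambda>i. z i - x i)"
    by (simp add: inner_d_def sum_subtractf right_diff_distrib)
  then show ?thesis
    using inner_d_le[of d w "\<lambda>i. z i - x i"] by (simp add: dist_d_def norm_d_def)
qed

lemma norm_d_eq_0_inner:
  assumes "norm_d d w = 0"
  shows "inner_d d w x = 0"
  using inner_d_le[of d w x] assms by simp

lemma dist_d_self [simp]: "dist_d d x x = 0"
  by (simp add: dist_d_def L2_set_def)

text \<open>Replaces the search for a perturbation by a margin test. One inclusion is
  Cauchy-Schwarz; the other needs perturbations that stay in the unit ball. Since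
  \<open>sign 0\<close> is \<open>1\<close>, a point labelled \<open>1\<close> must be pushed
  strictly across the hyperplane while one labelled \<open>-1\<close> need only touch it, hence one
  strict and one weak inequality.\<close>

lemma robust_error_halfspace:
  assumes "0 < \<gamma>" "\<gamma> \<le> 1"
  shows "robust_error d \<gamma> (halfspace d w) =
    {(x, y) \<in> unit_ball d \<times> labels.
       if y = 1 then inner_d d w x < \<gamma> * norm_d d w else inner_d d w x \<ge> - \<gamma> * norm_d d w}"
    (is "?L = ?R")
proof (intro set_eqI iffI)
  fix p assume "p \<in> ?L"
  then obtain x y z where p: "p = (x, y)" and xy: "x \<in> unit_ball d" "y \<in> labels"
    and z: "z \<in> unit_ball d" "dist_d d z x \<le> \<gamma>" "halfspace d w z \<noteq> y"
    unfolding robust_error_def by auto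
  have "norm_d d w * dist_d d z x \<le> norm_d d w * \<gamma>"
    using z by (intro mult_left_mono) auto
  then have "\<bar>inner_d d w z - inner_d d w x\<bar> \<le> \<gamma> * norm_d d w"
    using inner_d_diff_le[of d w z x] by (simp add: mult.commute)
  then show "p \<in> ?R"
    using p xy z by (auto simp: halfspace_def sign_def labels_def split: if_splits)
next
  fix p assume "p \<in> ?R"
  then obtain x y where p: "p = (x, y)" and xy: "x \<in> unit_ball d" "y \<in> labels"
    and R: "y = 1 \<Longrightarrow> inner_d d w x < \<gamma> * norm_d d w"
           "y = -1 \<Longrightarrow> inner_d d w x \<ge> - \<gamma> * norm_d d w"
    by (auto simp: labels_def)
  have "\<exists>z\<in>unit_ball d. dist_d d z x \<le> \<gamma> \<and> halfspace d w z \<noteq> y"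
  proof (cases "halfspace d w x = y")
    case False
    then show ?thesis using xy assms by (intro bexI[of _ x]) auto
  next
    case True
    \<comment> \<open>A null \<open>w\<close> labels every point \<open>1\<close>, so the correct
      label would be \<open>1\<close> and the margin condition would read
      \<open>0 < 0\<close>.\<close>
    have w: "norm_d d w > 0"
    proof (rule ccontr)
      assume "\<not> norm_d d w > 0"
      then have "norm_d d w = 0" using norm_d_nonneg[of d w] by linarith
      then show False
        using True R xy norm_d_eq_0_inner[of d w x]
        by (auto simp: halfspace_def sign_def labels_def split: if_splits)
    qed
    consider "y = 1" | "y = -1" using xy by (auto simp: labels_def)
    then show ?thesis
    proof cases
      case 1
      define a where "a = inner_d d w x / norm_d d w"
      have a: "0 \<le> inner_d d w x" "0 \<le> a" "a < \<gamma>"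
        using True 1 xy w R(1)[OF 1]
        by (auto simp: a_def halfspace_def sign_def field_simps split: if_splits)
      \<comment> \<open>The choice \<open>r = (\<gamma> - a) / 2\<close> spends the budget exactly,
        \<open>2 * r + a = \<gamma>\<close>, and is positive, so \<open>z\<close> lies strictly on
        the negative side.\<close>
      obtain z where z: "z \<in> unit_ball d" "dist_d d z x \<le> 2 * ((\<gamma> - a) / 2) + a"
          "inner_d d w z = - ((\<gamma> - a) / 2) * norm_d d w"
        using exists_close_below[of x d w "(\<gamma> - a) / 2"] xy w a assms unfolding a_def by auto
      have "inner_d d w z < 0" "dist_d d z x \<le> \<gamma>"
        using z w a by (simp add: mult_neg_pos, simp add: field_simps)
      then show ?thesis using z 1
        by (intro bexI[of _ z]) (auto simp: halfspace_def sign_def)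
    next
      case 2
      obtain z where z: "z \<in> unit_ball d" "dist_d d z x \<le> - inner_d d w x / norm_d d w"
          "inner_d d w z = 0"
        using exists_close_above[of x d w] xy w True 2
        by (auto simp: halfspace_def sign_def split: if_splits)
      moreover have "- inner_d d w x / norm_d d w \<le> \<gamma>"
        using R(2)[OF 2] w by (simp add: field_simps)
      ultimately show ?thesis using 2
        by (intro bexI[of _ z]) (auto simp: halfspace_def sign_def)
    qed
  qed
  then show "p \<in> ?L" using p xy by (auto simp: robust_error_def)
qed

section \<open>Measurability of robust errors\<close>

lemma unit_ball_sets: "unit_ball d \<in> sets (\<Pi>\<^sub>M i\<in>{..<d}. borel)"
proof -
  have "unit_ball d = {x \<in> space (\<Pi>\<^sub>M i\<in>{..<d}. borel). norm_d d x \<le> 1}"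
    by (auto simp: unit_ball_def space_PiM PiE_def)
  also have "\<dots> \<in> sets (\<Pi>\<^sub>M i\<in>{..<d}. borel)"
    unfolding norm_d_def L2_set_def by measurable
  finally show ?thesis .
qed

lemma space_example_space: "space (example_space d) = unit_ball d \<times> labels"
  using sets.sets_into_space[OF unit_ball_sets[of d]]
  by (auto simp: example_space_def space_pair_measure space_restrict_space)

lemma fst_component_measurable [measurable]:
  assumes "i < d"
  shows "(\<lambda>p. fst p i) \<in> borel_measurable (example_space d)"
proof -
  have "(\<lambda>x. x i) \<in> borel_measurable (restrict_space (\<Pi>\<^sub>M i\<in>{..<d}. borel) (unit_ball d))"
    using assms by (intro measurable_restrict_space1) measurable
  then show ?thesis
    unfolding example_space_def by (intro measurable_compose[OF measurable_fst])
qed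

lemma snd_measurable_example_space [measurable]:
  "snd \<in> measurable (example_space d) (count_space labels)"
  unfolding example_space_def by measurable

lemma inner_d_fst_measurable [measurable]:
  "(\<lambda>p. inner_d d w (fst p)) \<in> borel_measurable (example_space d)"
  unfolding inner_d_def by measurable

text \<open>The margin test involves a single inner product, so the uncountable union over
  perturbations in the definition disappears.\<close>

lemma robust_error_halfspace_sets:
  assumes "0 < \<gamma>" "\<gamma> \<le> 1"
  shows "robust_error d \<gamma> (halfspace d w) \<in> sets (example_space d)"
proof -
  have "robust_error d \<gamma> (halfspace d w) = {p \<in> space (example_space d).
     if snd p = 1 then inner_d d w (fst p) < \<gamma> * norm_d d w
     else inner_d d w (fst p) \<ge> - \<gamma> * norm_d d w}"
    unfolding robust_error_halfspace[OF assms] space_example_space by auto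
  also have "\<dots> \<in> sets (example_space d)"
    by measurable
  finally show ?thesis .
qed

section \<open>Rounding to integer normal vectors\<close>

text \<open>
  Greedy derandomised rounding: rounding \<open>a i\<close> down or up gives error factors of opposite signs, and
  the choice that makes the cross term with the errors made so far nonpositive keeps the second
  moment below the sum of the individual ones.
\<close>

lemma exists_rounding_second_moment:
  fixes f :: "'i \<Rightarrow> 'a \<Rightarrow> real" and a :: "'i \<Rightarrow> real"
  assumes "finite I"
    and "\<And>i j. i \<in> I \<Longrightarrow> j \<in> I \<Longrightarrow> integrable M (\<lambda>x. f i x * f j x)"
  shows "\<exists>v::'i \<Rightarrow> int. (\<forall>i\<in>I. \<bar>of_int (v i) - a i\<bar> \<le> 1) \<and>
    (\<integral>x. (\<Sum>i\<in>I. (of_int (v i) - a i) * f i x)\<^sup>2 \<partial>M) \<le> (\<Sum>i\<in>I. \<integral>x. (f i x)\<^sup>2 \<partial>M)"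
  using assms
proof (induction I rule: finite_induct)
  case (insert k I)
  then obtain v :: "'i \<Rightarrow> int" where v: "\<And>i. i \<in> I \<Longrightarrow> \<bar>of_int (v i) - a i\<bar> \<le> 1"
    and le: "(\<integral>x. (\<Sum>i\<in>I. (of_int (v i) - a i) * f i x)\<^sup>2 \<partial>M) \<le> (\<Sum>i\<in>I. \<integral>x. (f i x)\<^sup>2 \<partial>M)"
    by auto
  define S where "S x = (\<Sum>i\<in>I. (of_int (v i) - a i) * f i x)" for x
  have SS: "integrable M (\<lambda>x. (S x)\<^sup>2)"
  proof -
    have "(S x)\<^sup>2 = (\<Sum>i\<in>I. \<Sum>j\<in>I. ((of_int (v i) - a i) * (of_int (v j) - a j)) * (f i x * f j x))" for x
      unfolding S_def power2_eq_square sum_product by (intro sum.cong) (auto simp: mult_ac)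
    moreover have "integrable M (\<lambda>x. \<Sum>i\<in>I. \<Sum>j\<in>I.
        ((of_int (v i) - a i) * (of_int (v j) - a j)) * (f i x * f j x))"
      using insert.prems by (intro Bochner_Integration.integrable_sum integrable_mult_right) auto
    ultimately show ?thesis by simp
  qed
  have Sk: "integrable M (\<lambda>x. S x * f k x)"
  proof -
    have "S x * f k x = (\<Sum>i\<in>I. (of_int (v i) - a i) * (f i x * f k x))" for x
      unfolding S_def sum_distrib_right by (intro sum.cong) (auto simp: mult_ac)
    moreover have "integrable M (\<lambda>x. \<Sum>i\<in>I. (of_int (v i) - a i) * (f i x * f k x))"
      using insert.prems by (intro Bochner_Integration.integrable_sum integrable_mult_right) auto
    ultimately show ?thesis by simp
  qed
  have kk: "integrable M (\<lambda>x. (f k x)\<^sup>2)"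
    using insert.prems[of k k] by (simp add: power2_eq_square)
  define c where "c = (\<integral>x. S x * f k x \<partial>M)"
  obtain m :: int where m: "\<bar>of_int m - a k\<bar> \<le> 1" "(of_int m - a k) * c \<le> 0"
  proof (cases "c \<ge> 0")
    case True
    have "\<bar>of_int \<lfloor>a k\<rfloor> - a k\<bar> \<le> 1" "(of_int \<lfloor>a k\<rfloor> - a k) * c \<le> 0"
      using True by (linarith, simp add: mult_nonpos_nonneg)
    then show ?thesis by (rule that)
  next
    case False
    have "\<bar>of_int \<lceil>a k\<rceil> - a k\<bar> \<le> 1" "(of_int \<lceil>a k\<rceil> - a k) * c \<le> 0"
      using False by (linarith, simp add: mult_nonneg_nonpos)
    then show ?thesis by (rule that)
  qed
  define e where "e = of_int m - a k"
  have e2: "e\<^sup>2 \<le> 1" using m by (simp add: e_def abs_square_le_1)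
  define v' where "v' = v(k := m)"
  have S': "(\<Sum>i\<in>insert k I. (of_int (v' i) - a i) * f i x) = S x + e * f k x" for x
  proof -
    have "(\<Sum>i\<in>I. (of_int (v' i) - a i) * f i x) = S x"
      unfolding S_def v'_def using insert.hyps by (intro sum.cong) auto
    then show ?thesis using insert.hyps by (simp add: v'_def e_def)
  qed
  have "(\<integral>x. (S x + e * f k x)\<^sup>2 \<partial>M)
      = (\<integral>x. (S x)\<^sup>2 + (2 * e * (S x * f k x) + e\<^sup>2 * (f k x)\<^sup>2) \<partial>M)"
    by (intro Bochner_Integration.integral_cong) (auto simp: power2_eq_square algebra_simps)
  also have "\<dots> = (\<integral>x. (S x)\<^sup>2 \<partial>M) + (2 * (e * c) + e\<^sup>2 * (\<integral>x. (f k x)\<^sup>2 \<partial>M))"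
    using SS Sk kk by (simp add: c_def)
  \<comment> \<open>The cross term \<open>e * c\<close> is nonpositive by the choice of
    \<open>m\<close>, and \<open>e\<^sup>2 \<le> 1\<close>.\<close>
  also have "\<dots> \<le> (\<Sum>i\<in>I. \<integral>x. (f i x)\<^sup>2 \<partial>M) + (0 + 1 * (\<integral>x. (f k x)\<^sup>2 \<partial>M))"
    using le m e2 unfolding S_def[symmetric] e_def[symmetric]
    by (intro add_mono mult_right_mono) (auto simp: mult.commute)
  also have "\<dots> = (\<Sum>i\<in>insert k I. \<integral>x. (f i x)\<^sup>2 \<partial>M)"
    using insert.hyps by simp
  finally show ?case
    using v m insert.hyps unfolding S'[symmetric]
    by (intro exI[of _ v'] conjI) (auto simp: v'_def)
qed simp

lemma example_distributionD:
  assumes "example_distribution d D"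
  shows "prob_space D" "sets D = sets (example_space d)" "space D = unit_ball d \<times> labels"
    "measurable D N = measurable (example_space d) N"
  using assms sets_eq_imp_space_eq[of D "example_space d"] measurable_cong_sets[of D "example_space d" N N]
  by (auto simp: example_distribution_def space_example_space)

text \<open>The coordinatewise second moments add up to the mean of the squared norm, which is at
  most \<open>1\<close> on the unit ball. The rounding error therefore has a second moment bounded
  independently of \<open>d\<close>, and Chebyshev's inequality applies.\<close>

lemma exists_integer_direction:
  assumes D: "example_distribution d D" and t: "t > 0"
  shows "\<exists>v::nat \<Rightarrow> int. (\<forall>i<d. \<bar>of_int (v i) - a i\<bar> \<le> 1) \<and>
    measure D {p \<in> space D. t \<le> \<bar>inner_d d (\<lambda>i. of_int (v i) - a i) (fst p)\<bar>} \<le> 1 / t\<^sup>2"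
proof -
  note DD = example_distributionD[OF D]
  interpret D: prob_space D by fact
  have [measurable]: "(\<lambda>p. fst p i) \<in> borel_measurable D" if "i < d" for i
    using that by (simp add: DD)
  have [measurable]: "(\<lambda>p. inner_d d w (fst p)) \<in> borel_measurable D" for w
    by (simp add: DD)
  have bound: "\<bar>fst p i\<bar> \<le> 1" if "i < d" "p \<in> space D" for p i
    using that unit_ball_abs_le[of "fst p" d i] by (auto simp: DD)
  have int: "integrable D (\<lambda>p. fst p i * fst p j)" if "i < d" "j < d" for i j
  proof (rule D.integrable_const_bound[where B = 1])
    show "AE p in D. norm (fst p i * fst p j) \<le> 1"
      using bound that by (intro AE_I2) (auto simp: abs_mult intro!: mult_le_one)
  qed (use that in measurable)
  obtain v :: "nat \<Rightarrow> int" where v: "\<And>i. i < d \<Longrightarrow> \<bar>of_int (v i) - a i\<bar> \<le> 1"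
    and le: "(\<integral>p. (\<Sum>i<d. (of_int (v i) - a i) * fst p i)\<^sup>2 \<partial>D) \<le> (\<Sum>i<d. \<integral>p. (fst p i)\<^sup>2 \<partial>D)"
    using exists_rounding_second_moment[of "{..<d}" D "\<lambda>i p. fst p i" a] int by auto
  define e where "e = (\<lambda>i. of_int (v i) - a i)"
  have "(\<Sum>i<d. \<integral>p. (fst p i)\<^sup>2 \<partial>D) = (\<integral>p. (\<Sum>i<d. (fst p i)\<^sup>2) \<partial>D)"
    using int by (intro Bochner_Integration.integral_sum[symmetric]) (auto simp: power2_eq_square)
  also have "\<dots> \<le> (\<integral>p. 1 \<partial>D)"
  proof (rule Bochner_Integration.integral_mono)
    show "integrable D (\<lambda>p. \<Sum>i<d. (fst p i)\<^sup>2)"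
      using int by (intro Bochner_Integration.integrable_sum) (auto simp: power2_eq_square)
    show "(\<Sum>i<d. (fst p i)\<^sup>2) \<le> 1" if "p \<in> space D" for p
    proof -
      have "(\<Sum>i<d. (fst p i)\<^sup>2) = (norm_d d (fst p))\<^sup>2"
        by (subst inner_d_self[symmetric]) (simp add: inner_d_def power2_eq_square)
      also have "\<dots> \<le> 1"
        using that by (intro power_le_one) (auto simp: DD unit_ball_def)
      finally show ?thesis .
    qed
  qed simp
  also have "\<dots> = 1" by (simp add: D.prob_space)
  finally have second: "(\<integral>p. (inner_d d e (fst p))\<^sup>2 \<partial>D) \<le> 1"
    using le by (simp add: inner_d_def e_def)
  have int2: "integrable D (\<lambda>p. (inner_d d e (fst p))\<^sup>2)"
  proof (rule D.integrable_const_bound[where B = "(norm_d d e)\<^sup>2"])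
    have "(inner_d d e x)\<^sup>2 \<le> (norm_d d e)\<^sup>2" if "x \<in> unit_ball d" for x
    proof -
      have "\<bar>inner_d d e x\<bar> \<le> norm_d d e * norm_d d x" by (rule inner_d_le)
      also have "\<dots> \<le> norm_d d e * 1"
        using that by (intro mult_left_mono) (auto simp: unit_ball_def)
      finally show ?thesis by (simp add: abs_le_square_iff[symmetric])
    qed
    then show "AE p in D. norm ((inner_d d e (fst p))\<^sup>2) \<le> (norm_d d e)\<^sup>2"
      by (intro AE_I2) (auto simp: DD)
  qed measurable
  have "{p \<in> space D. t \<le> \<bar>inner_d d e (fst p)\<bar>} = {p \<in> space D. t\<^sup>2 \<le> (inner_d d e (fst p))\<^sup>2}"
    using t by (auto simp: abs_le_square_iff[symmetric])
  also have "measure D \<dots> \<le> (\<integral>p. (inner_d d e (fst p))\<^sup>2 \<partial>D) / t\<^sup>2"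
    using t int2 by (intro integral_Markov_inequality_measure[where A = "{}"]) auto
  also have "\<dots> \<le> 1 / t\<^sup>2"
    using second by (intro divide_right_mono) auto
  finally show ?thesis using v by (auto simp: e_def)
qed

section \<open>Counting integer vectors of bounded norm\<close>

definition integer_ball :: "nat \<Rightarrow> nat \<Rightarrow> (nat \<Rightarrow> int) set" where
  "integer_ball d M = {v \<in> {..<d} \<rightarrow>\<^sub>E UNIV. (\<Sum>i<d. (v i)\<^sup>2) \<le> int M}"

text \<open>Integers satisfy \<open>\<bar>k\<bar> \<le> k\<^sup>2\<close>. The box is crude, but
  sums of products over it factorise by coordinate.\<close>

lemma integer_ball_subset: "integer_ball d M \<subseteq> {..<d} \<rightarrow>\<^sub>E {- int M..int M}"
proof
  fix v assume v: "v \<in> integer_ball d M"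
  have "\<bar>v i\<bar> \<le> int M" if "i < d" for i
  proof -
    have "\<bar>v i\<bar> \<le> (v i)\<^sup>2"
      using self_le_power[of "\<bar>v i\<bar>" 2] by (cases "v i = 0") auto
    also have "\<dots> \<le> (\<Sum>i<d. (v i)\<^sup>2)" using that by (intro member_le_sum) auto
    also have "\<dots> \<le> int M" using v by (simp add: integer_ball_def)
    finally show ?thesis .
  qed
  then show "v \<in> {..<d} \<rightarrow>\<^sub>E {- int M..int M}"
    using v unfolding integer_ball_def PiE_iff by (auto simp: abs_le_iff minus_le_iff)
qed

lemma finite_integer_ball: "finite (integer_ball d M)"
  by (rule finite_subset[OF integer_ball_subset]) (intro finite_PiE, auto)

text \<open>A partial theta series, compared through \<open>k \<le> k\<^sup>2\<close> with the
  geometric series \<open>1 + 2 * (1/2 + 1/4 + ...) = 3\<close>. The subtracted tail is what makes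
  the induction close.\<close>

lemma sum_half_power_square_le:
  "(\<Sum>k\<in>{- int N..int N}. (1 / 2 :: real) ^ nat (k\<^sup>2)) \<le> 3 - 2 * (1 / 2) ^ N"
proof (induction N)
  case (Suc N)
  have eq: "{- int (Suc N)..int (Suc N)} =
      insert (- int (Suc N)) (insert (int (Suc N)) {- int N..int N})"
    by auto
  have "Suc N \<le> nat ((int (Suc N))\<^sup>2)"
    by (metis nat_int of_nat_power power2_nat_le_imp_le le_refl)
  then have "(1 / 2 :: real) ^ nat ((int (Suc N))\<^sup>2) \<le> (1 / 2) ^ Suc N"
    by (intro power_decreasing) auto
  then show ?case
    unfolding eq using Suc.IH by (simp del: of_nat_Suc)
qed simp

text \<open>Each vector in the ball has weight \<open>2 ^ M * ?w v\<close> at least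
  \<open>1\<close>. Extending the sum of weights to the box turns it into \<open>2 ^ M\<close> times
  a product of \<open>d\<close> theta sums, each at most \<open>3\<close>.\<close>

lemma card_integer_ball_le: "real (card (integer_ball d M)) \<le> 2 ^ M * 3 ^ d"
proof -
  let ?w = "\<lambda>v::nat \<Rightarrow> int. \<Prod>i<d. (1 / 2 :: real) ^ nat ((v i)\<^sup>2)"
  have "1 \<le> 2 ^ M * ?w v" if "v \<in> integer_ball d M" for v
  proof -
    have "?w v = (1 / 2) ^ (\<Sum>i<d. nat ((v i)\<^sup>2))"
      by (rule power_sum[symmetric])
    also have "(\<Sum>i<d. nat ((v i)\<^sup>2)) = nat (\<Sum>i<d. (v i)\<^sup>2)"
      by (metis (mono_tags, lifting) int_nat_eq nat_int of_nat_sum sum.cong zero_le_power2)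
    finally have w: "?w v = (1 / 2) ^ nat (\<Sum>i<d. (v i)\<^sup>2)" .
    have "nat (\<Sum>i<d. (v i)\<^sup>2) \<le> M"
      using that by (simp add: integer_ball_def nat_le_iff)
    then have "?w v \<ge> (1 / 2) ^ M"
      unfolding w by (intro power_decreasing) simp_all
    then have "2 ^ M * (1 / 2) ^ M \<le> 2 ^ M * ?w v"
      by (rule mult_left_mono) simp
    moreover have "2 ^ M * (1 / 2 :: real) ^ M = 1"
      by (simp flip: power_mult_distrib)
    ultimately show ?thesis by simp
  qed
  then have "real (card (integer_ball d M)) \<le> (\<Sum>v\<in>integer_ball d M. 2 ^ M * ?w v)"
    using sum_bounded_below[of "integer_ball d M" 1 "\<lambda>v. 2 ^ M * ?w v"] by simp
  also have "\<dots> \<le> (\<Sum>v\<in>{..<d} \<rightarrow>\<^sub>E {- int M..int M}. 2 ^ M * ?w v)"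
    using integer_ball_subset
    by (intro sum_mono2) (auto simp: finite_PiE intro!: mult_nonneg_nonneg prod_nonneg)
  also have "\<dots> = 2 ^ M * (\<Prod>i<d. \<Sum>k\<in>{- int M..int M}. (1 / 2) ^ nat (k\<^sup>2))"
    by (subst prod_sum_PiE) (auto simp: sum_distrib_left)
  also have "\<dots> \<le> 2 ^ M * (\<Prod>i<d. 3)"
    using order_trans[OF sum_half_power_square_le[of M], of 3]
    by (intro mult_left_mono prod_mono) (auto intro!: sum_nonneg)
  finally show ?thesis by simp
qed

section \<open>The exponential mechanism\<close>

definition error_count :: "nat \<Rightarrow> real \<Rightarrow> hypothesis \<Rightarrow> example multiset \<Rightarrow> real" where
  "error_count d \<gamma> h X = (\<Sum>p\<in>#X. indicator (robust_error d \<gamma> h) p)"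

definition gibbs_normalizer :: "'h set \<Rightarrow> ('h \<Rightarrow> real) \<Rightarrow> real" where
  "gibbs_normalizer H u = (\<Sum>h\<in>H. exp (- u h))"

definition gibbs :: "'h set \<Rightarrow> ('h \<Rightarrow> real) \<Rightarrow> 'h \<Rightarrow> real" where
  "gibbs H u h = exp (- u h) / gibbs_normalizer H u"

text \<open>Mapping the point measure on \<open>H\<close> by the identity into
  \<open>count_space (hypotheses d)\<close> makes all sets of hypotheses measurable, as
  \<open>randomized_algorithm\<close> demands. The parameter \<open>s\<close> is an inverse
  temperature.\<close>

definition exponential_mechanism :: "nat \<Rightarrow> real \<Rightarrow> real \<Rightarrow> hypothesis set \<Rightarrow> learner" where
  "exponential_mechanism d \<gamma> s H X =
     distr (point_measure H (\<lambda>h. ennreal (gibbs H (\<lambda>h. s * error_count d \<gamma> h X) h)))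
       (count_space (hypotheses d)) (\<lambda>h. h)"

lemma gibbs_normalizer_pos: "finite H \<Longrightarrow> H \<noteq> {} \<Longrightarrow> 0 < gibbs_normalizer H u"
  unfolding gibbs_normalizer_def by (rule sum_pos) auto

lemma gibbs_nonneg: "0 \<le> gibbs H u h"
  by (simp add: gibbs_def gibbs_normalizer_def sum_nonneg)

lemma sum_gibbs: "finite H \<Longrightarrow> H \<noteq> {} \<Longrightarrow> (\<Sum>h\<in>H. gibbs H u h) = 1"
  using gibbs_normalizer_pos[of H u]
  by (simp add: gibbs_def gibbs_normalizer_def flip: sum_divide_distrib)

text \<open>The numerator and the normalizer each change by a factor of at most
  \<open>exp s\<close>, hence \<open>exp (2 * s)\<close>.\<close>

lemma gibbs_ratio:
  assumes "finite H" "H \<noteq> {}" and h: "h \<in> H" and close: "\<And>h. h \<in> H \<Longrightarrow> \<bar>u h - u' h\<bar> \<le> s"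
  shows "gibbs H u h \<le> exp (2 * s) * gibbs H u' h"
proof -
  have Z: "gibbs_normalizer H u > 0" "gibbs_normalizer H u' > 0"
    using assms gibbs_normalizer_pos by auto
  \<comment> \<open>Stated for arbitrary \<open>v\<close> and \<open>v'\<close> because it is used
    in both directions: from \<open>u'\<close> to \<open>u\<close> in the normalizer, from
    \<open>u\<close> to \<open>u'\<close> in the numerator.\<close>
  have *: "exp (- v h') \<le> exp s * exp (- v' h')"
    if "h' \<in> H" "\<bar>v h' - v' h'\<bar> \<le> s" for h' and v v' :: "_ \<Rightarrow> real"
    using that by (simp flip: exp_add)
  have "gibbs_normalizer H u' \<le> exp s * gibbs_normalizer H u"
    unfolding gibbs_normalizer_def sum_distrib_left
    using close by (intro sum_mono *) (auto simp: abs_minus_commute)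
  then have "1 / gibbs_normalizer H u \<le> exp s * (1 / gibbs_normalizer H u')"
    using Z by (simp add: field_simps)
  then have "exp (- u h) * (1 / gibbs_normalizer H u)
      \<le> (exp s * exp (- u' h)) * (exp s * (1 / gibbs_normalizer H u'))"
    using h close Z by (intro mult_mono *) auto
  moreover have "exp (2 * s) = exp s * exp s"
    by (simp flip: exp_add)
  ultimately show ?thesis
    by (simp add: gibbs_def mult_ac)
qed

text \<open>Only the term of \<open>h\<^sub>0\<close> is kept in the normalizer.\<close>

lemma gibbs_le_exp_diff:
  assumes "finite H" "h\<^sub>0 \<in> H"
  shows "gibbs H u h \<le> exp (u h\<^sub>0 - u h)"
proof -
  have "exp (- u h\<^sub>0) \<le> gibbs_normalizer H u"
    unfolding gibbs_normalizer_def using assms by (intro member_le_sum) auto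
  then have "gibbs H u h \<le> exp (- u h) / exp (- u h\<^sub>0)"
    unfolding gibbs_def by (intro divide_left_mono) (auto simp: zero_less_mult_iff intro: less_le_trans[of _ "exp (- u h\<^sub>0)"])
  then show ?thesis by (simp flip: exp_diff)
qed

lemma emeasure_exponential_mechanism:
  assumes "finite H" "H \<subseteq> hypotheses d" "S \<subseteq> hypotheses d"
  shows "emeasure (exponential_mechanism d \<gamma> s H X) S
    = ennreal (\<Sum>h\<in>H \<inter> S. gibbs H (\<lambda>h. s * error_count d \<gamma> h X) h)"
proof -
  have "(\<lambda>h. h) \<in> measurable (point_measure H f) (count_space (hypotheses d))" for f
    using assms by (simp add: measurable_point_measure_eq1) auto
  then show ?thesis
    unfolding exponential_mechanism_def using assms
    by (simp add: emeasure_distr space_point_measure emeasure_point_measure_finite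
        sum_ennreal gibbs_nonneg Int_commute)
qed

lemma sets_exponential_mechanism: "sets (exponential_mechanism d \<gamma> s H X) = Pow (hypotheses d)"
  and space_exponential_mechanism: "space (exponential_mechanism d \<gamma> s H X) = hypotheses d"
  by (simp_all add: exponential_mechanism_def)

lemma prob_space_exponential_mechanism:
  assumes "finite H" "H \<noteq> {}" "H \<subseteq> hypotheses d"
  shows "prob_space (exponential_mechanism d \<gamma> s H X)"
proof
  have "H \<inter> hypotheses d = H" using assms by auto
  then show "emeasure (exponential_mechanism d \<gamma> s H X) (space (exponential_mechanism d \<gamma> s H X)) = 1"
    using assms by (simp add: space_exponential_mechanism emeasure_exponential_mechanism sum_gibbs)
qed

lemma error_count_add_mset:
  "error_count d \<gamma> h (add_mset p X) = indicator (robust_error d \<gamma> h) p + error_count d \<gamma> h X"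
  by (simp add: error_count_def)

lemma error_count_image_mset:
  "error_count d \<gamma> h (image_mset \<omega> (mset_set {..<n})) = (\<Sum>i<n. indicator (robust_error d \<gamma> h) (\<omega> i))"
  by (simp add: error_count_def sum_unfold_sum_mset multiset.map_comp comp_def)

text \<open>Adding or removing one example changes each error count by at most \<open>1\<close>, so
  the exponents move by at most \<open>s\<close>; the pointwise ratio bound is then summed over
  \<open>S\<close>.\<close>

lemma differentially_private_exponential_mechanism:
  assumes H: "finite H" "H \<noteq> {}" "H \<subseteq> hypotheses d" and s: "0 \<le> s"
  shows "differentially_private d (2 * s) 0 (exponential_mechanism d \<gamma> s H)"
  unfolding differentially_private_def
proof (intro ballI impI allI)
  fix X X' S assume n: "neighbours X X'" and S: "S \<subseteq> hypotheses d"
  have "\<bar>error_count d \<gamma> h X - error_count d \<gamma> h X'\<bar> \<le> 1" for h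
    using n by (auto simp: neighbours_def error_count_add_mset indicator_def)
  then have close: "\<bar>s * error_count d \<gamma> h X - s * error_count d \<gamma> h X'\<bar> \<le> s" for h
    using s by (simp add: mult_left_le flip: right_diff_distrib abs_mult_pos')
  have "(\<Sum>h\<in>H \<inter> S. gibbs H (\<lambda>h. s * error_count d \<gamma> h X) h)
      \<le> (\<Sum>h\<in>H \<inter> S. exp (2 * s) * gibbs H (\<lambda>h. s * error_count d \<gamma> h X') h)"
    using H close by (intro sum_mono gibbs_ratio) auto
  then show "measure (exponential_mechanism d \<gamma> s H X) S
      \<le> exp (2 * s) * measure (exponential_mechanism d \<gamma> s H X') S + 0"
    using H S by (simp add: measure_def emeasure_exponential_mechanism gibbs_nonneg sum_nonneg
        sum_distrib_left)
qed

section \<open>Accuracy of the mechanism on an i.i.d. sample\<close>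

context
  fixes d n :: nat and \<gamma> s :: real and H :: "hypothesis set"
  assumes H: "finite H" "H \<noteq> {}" "H \<subseteq> hypotheses d"
    and meas: "\<And>h. h \<in> H \<Longrightarrow> robust_error d \<gamma> h \<in> sets (example_space d)"
begin

lemma error_count_sample_measurable:
  assumes "h \<in> H"
  shows "(\<lambda>\<omega>. error_count d \<gamma> h (image_mset \<omega> (mset_set {..<n})))
    \<in> borel_measurable (\<Pi>\<^sub>M i\<in>{..<n}. example_space d)"
  unfolding error_count_image_mset using meas[OF assms] by measurable

text \<open>The probability of any set is a finite sum of ratios of exponentials of error counts,
  each of them measurable in the sample.\<close>

lemma run_exponential_mechanism_measurable:
  "run_on_sample n (exponential_mechanism d \<gamma> s H)
    \<in> (\<Pi>\<^sub>M i\<in>{..<n}. example_space d) \<rightarrow>\<^sub>M prob_algebra (count_space (hypotheses d))"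
proof (intro measurable_prob_algebraI measurable_subprob_algebra)
  fix S assume "S \<in> sets (count_space (hypotheses d))"
  then have "S \<subseteq> hypotheses d" by simp
  then show "(\<lambda>\<omega>. emeasure (run_on_sample n (exponential_mechanism d \<gamma> s H) \<omega>) S)
      \<in> borel_measurable (\<Pi>\<^sub>M i\<in>{..<n}. example_space d)"
    unfolding run_on_sample_def using H
    by (simp add: emeasure_exponential_mechanism gibbs_def gibbs_normalizer_def)
      (intro measurable_compose[OF _ measurable_ennreal] borel_measurable_sum
        borel_measurable_divide measurable_compose[OF _ borel_measurable_exp] borel_measurable_uminus
        borel_measurable_times borel_measurable_const error_count_sample_measurable; auto)
qed (auto simp: run_on_sample_def prob_space_exponential_mechanism H sets_exponential_mechanism
      prob_space_imp_subprob_space)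

text \<open>Linearity of expectation: each coordinate of the product measure has law
  \<open>D\<close>.\<close>

lemma nn_integral_error_count:
  assumes D: "example_distribution d D" and h: "h \<in> H"
  shows "(\<integral>\<^sup>+\<omega>. ennreal (error_count d \<gamma> h (image_mset \<omega> (mset_set {..<n}))) \<partial>(\<Pi>\<^sub>M i\<in>{..<n}. D))
    = ennreal (real n * robust_risk d \<gamma> h D)"
proof -
  note DD = example_distributionD[OF D]
  interpret D: prob_space D by fact
  let ?E = "robust_error d \<gamma> h"
  have E [measurable]: "?E \<in> sets D" using meas[OF h] by (simp add: DD)
  have "(\<integral>\<^sup>+\<omega>. ennreal (error_count d \<gamma> h (image_mset \<omega> (mset_set {..<n}))) \<partial>(\<Pi>\<^sub>M i\<in>{..<n}. D))
      = (\<integral>\<^sup>+\<omega>. (\<Sum>i<n. indicator ?E (\<omega> i)) \<partial>(\<Pi>\<^sub>M i\<in>{..<n}. D))"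
    unfolding error_count_image_mset
    by (simp add: ennreal_indicator flip: sum_ennreal)
  also have "\<dots> = (\<Sum>i<n. \<integral>\<^sup>+\<omega>. indicator ?E (\<omega> i) \<partial>(\<Pi>\<^sub>M i\<in>{..<n}. D))"
    by (intro nn_integral_sum) measurable
  also have "\<dots> = (\<Sum>i<n. \<integral>\<^sup>+p. indicator ?E p \<partial>D)"
  proof (intro sum.cong refl)
    fix i assume i: "i \<in> {..<n}"
    have "(\<integral>\<^sup>+p. indicator ?E p \<partial>D)
        = (\<integral>\<^sup>+p. indicator ?E p \<partial>distr (\<Pi>\<^sub>M i\<in>{..<n}. D) D (\<lambda>\<omega>. \<omega> i))"
      using i distr_PiM_component[of "{..<n}" "\<lambda>_. D" i] D.prob_space_axioms by simp
    also have "\<dots> = (\<integral>\<^sup>+\<omega>. indicator ?E (\<omega> i) \<partial>(\<Pi>\<^sub>M i\<in>{..<n}. D))"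
      using i by (intro nn_integral_distr) auto
    finally show "(\<integral>\<^sup>+\<omega>. indicator ?E (\<omega> i) \<partial>(\<Pi>\<^sub>M i\<in>{..<n}. D)) = (\<integral>\<^sup>+p. indicator ?E p \<partial>D)" ..
  qed
  also have "\<dots> = ennreal (real n * robust_risk d \<gamma> h D)"
    by (simp add: robust_risk_def D.emeasure_eq_measure ennreal_mult ennreal_of_nat_eq_real_of_nat)
  finally show ?thesis .
qed

text \<open>Chernoff-type bound. With \<open>p\<close> the risk, one example contributes the factor
  \<open>1 - p * (1 - exp (- s))\<close>, at most \<open>exp (- \<alpha> * (1 - exp (- s)))\<close>
  by \<open>1 + x \<le> exp x\<close>; independence gives the \<open>n\<close>-th power.\<close>

lemma nn_integral_exp_error_count:
  assumes D: "example_distribution d D" and h: "h \<in> H" and s: "0 \<le> s"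
    and risk: "\<alpha> \<le> robust_risk d \<gamma> h D"
  shows "(\<integral>\<^sup>+\<omega>. ennreal (exp (- s * error_count d \<gamma> h (image_mset \<omega> (mset_set {..<n})))) \<partial>(\<Pi>\<^sub>M i\<in>{..<n}. D))
    \<le> ennreal (exp (- real n * \<alpha> * (1 - exp (- s))))"
proof -
  note DD = example_distributionD[OF D]
  interpret D: prob_space D by fact
  interpret P: product_sigma_finite "\<lambda>_. D" ..
  let ?E = "robust_error d \<gamma> h"
  have E [measurable]: "?E \<in> sets D" using meas[OF h] by (simp add: DD)
  have eq: "(\<integral>\<^sup>+p. ennreal (exp (- s * indicator ?E p)) \<partial>D)
      = ennreal (1 - measure D ?E * (1 - exp (- s)))"
  proof -
    have "exp (- s * indicator ?E p) = 1 - (1 - exp (- s)) * indicator ?E p" for p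
      by (simp add: indicator_def)
    moreover have ind: "integrable D (indicator ?E :: _ \<Rightarrow> real)"
      by (rule integrable_real_indicator) (auto simp: D.emeasure_eq_measure)
    moreover have "(\<integral>\<^sup>+p. ennreal (1 - (1 - exp (- s)) * indicator ?E p) \<partial>D)
        = ennreal (\<integral>p. 1 - (1 - exp (- s)) * indicator ?E p \<partial>D)"
    proof (rule nn_integral_eq_integral)
      show "integrable D (\<lambda>p. 1 - (1 - exp (- s)) * indicator ?E p)"
        by (intro Bochner_Integration.integrable_diff integrable_mult_right D.integrable_const ind)
    qed (use s in \<open>auto simp: indicator_def\<close>)
    ultimately show ?thesis
      by (simp add: D.prob_space mult.commute)
  qed
  have "(\<integral>\<^sup>+\<omega>. ennreal (exp (- s * error_count d \<gamma> h (image_mset \<omega> (mset_set {..<n})))) \<partial>(\<Pi>\<^sub>M i\<in>{..<n}. D))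
      = (\<integral>\<^sup>+\<omega>. (\<Prod>i<n. ennreal (exp (- s * indicator ?E (\<omega> i)))) \<partial>(\<Pi>\<^sub>M i\<in>{..<n}. D))"
    unfolding error_count_image_mset sum_distrib_left 
    by (simp only: exp_sum[OF finite_lessThan] prod_ennreal[OF exp_ge_zero])
  also have "\<dots> = (\<Prod>i<n. \<integral>\<^sup>+p. ennreal (exp (- s * indicator ?E p)) \<partial>D)"
    by (intro P.product_nn_integral_prod) auto
  also have "\<dots> = ennreal (1 - measure D ?E * (1 - exp (- s))) ^ n"
    unfolding eq by simp
  also have "\<dots> \<le> ennreal (exp (- \<alpha> * (1 - exp (- s)))) ^ n"
  proof (intro power_mono ennreal_leI)
    have "\<alpha> * (1 - exp (- s)) \<le> measure D ?E * (1 - exp (- s))"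
      using risk s by (intro mult_right_mono) (auto simp: robust_risk_def)
    then show "1 - measure D ?E * (1 - exp (- s)) \<le> exp (- \<alpha> * (1 - exp (- s)))"
      using exp_ge_add_one_self[of "- \<alpha> * (1 - exp (- s))"] by simp
  qed simp
  also have "\<dots> = ennreal (exp (- real n * \<alpha> * (1 - exp (- s))))"
    by (simp only: ennreal_power[OF exp_ge_zero] exp_of_nat_mult[symmetric] mult_minus_left
        mult_minus_right mult.assoc)
  finally show ?thesis .
qed

text \<open>
  For a bad hypothesis the Gibbs weight is at most \<open>exp (s q\<^sub>0 - s q)\<close>. Where the error count \<open>q\<^sub>0\<close> of the
  good hypothesis \<open>h\<^sub>0\<close> is at most \<open>m\<close> its factor is bounded by \<open>exp (s m)\<close>; elsewhere the failure
  probability is bounded by \<open>1 \<le> q\<^sub>0 / m\<close>. The expectation of \<open>exp (- s q)\<close> over the sample factorises, so no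
  uniform convergence is needed.
\<close>

lemma exponential_mechanism_failure:
  assumes D: "example_distribution d D" and s: "0 \<le> s"
    and h\<^sub>0: "h\<^sub>0 \<in> H" "robust_risk d \<gamma> h\<^sub>0 D \<le> \<beta>" and m: "0 < m"
  shows "emeasure (bind (\<Pi>\<^sub>M i\<in>{..<n}. D) (run_on_sample n (exponential_mechanism d \<gamma> s H)))
      (hypotheses d - {h \<in> hypotheses d. robust_error d \<gamma> h \<in> sets D \<and> robust_risk d \<gamma> h D \<le> \<alpha>})
    \<le> ennreal (real n * \<beta> / m + real (card H) * exp (s * m - real n * \<alpha> * (1 - exp (- s))))"
    (is "emeasure (bind ?P ?R) ?B \<le> _")
proof -
  note DD = example_distributionD[OF D]
  interpret D: prob_space D by fact
  interpret P: prob_space ?P by (intro prob_space_PiM D.prob_space_axioms)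
  have sets_P: "sets ?P = sets (\<Pi>\<^sub>M i\<in>{..<n}. example_space d)"
    by (intro sets_PiM_cong) (auto simp: DD)
  have R: "?R \<in> ?P \<rightarrow>\<^sub>M prob_algebra (count_space (hypotheses d))"
    using run_exponential_mechanism_measurable by (simp add: measurable_cong_sets[OF sets_P refl])
  have q [measurable]: "(\<lambda>\<omega>. error_count d \<gamma> h (image_mset \<omega> (mset_set {..<n}))) \<in> borel_measurable ?P"
    if "h \<in> H" for h
    using error_count_sample_measurable[OF that] by (simp add: measurable_cong_sets[OF sets_P refl])
  define q where "q h \<omega> = error_count d \<gamma> h (image_mset \<omega> (mset_set {..<n}))" for h \<omega>
  have q_nonneg: "0 \<le> q h \<omega>" for h \<omega>
    unfolding q_def error_count_image_mset by (intro sum_nonneg) auto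
  let ?HB = "H \<inter> ?B"
  \<comment> \<open>The failure event also contains hypotheses with a nonmeasurable robust error,
    but \<open>meas\<close> excludes those from \<open>H\<close>, so only a large risk
    remains.\<close>
  have bad: "\<alpha> \<le> robust_risk d \<gamma> h D" if "h \<in> ?HB" for h
    using that meas[of h] by (auto simp: DD)
  have pointwise: "emeasure (?R \<omega>) ?B
      \<le> ennreal (1 / m) * ennreal (q h\<^sub>0 \<omega>) + (\<Sum>h\<in>?HB. ennreal (exp (s * m)) * ennreal (exp (- s * q h \<omega>)))"
    for \<omega>
  proof -
    let ?g = "\<lambda>h. gibbs H (\<lambda>h. s * q h \<omega>) h"
    have "(\<Sum>h\<in>?HB. ?g h) \<le> 1 / m * q h\<^sub>0 \<omega> + (\<Sum>h\<in>?HB. exp (s * m) * exp (- s * q h \<omega>))"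
    proof (cases "q h\<^sub>0 \<omega> \<le> m")
      case True
      have "?g h \<le> exp (s * m) * exp (- s * q h \<omega>)" for h
      proof -
        have "?g h \<le> exp (s * q h\<^sub>0 \<omega> - s * q h \<omega>)"
          using gibbs_le_exp_diff[OF H(1) h\<^sub>0(1)] .
        also have "\<dots> \<le> exp (s * m - s * q h \<omega>)"
          using True s by (simp add: mult_left_mono)
        also have "\<dots> = exp (s * m) * exp (- s * q h \<omega>)"
          by (simp flip: exp_add)
        finally show ?thesis .
      qed
      then have "(\<Sum>h\<in>?HB. ?g h) \<le> (\<Sum>h\<in>?HB. exp (s * m) * exp (- s * q h \<omega>))"
        by (intro sum_mono)
      moreover have "0 \<le> 1 / m * q h\<^sub>0 \<omega>" using m q_nonneg by simp
      ultimately show ?thesis by linarith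
    next
      case False
      have "(\<Sum>h\<in>?HB. ?g h) \<le> (\<Sum>h\<in>H. ?g h)"
        using H by (intro sum_mono2) (auto simp: gibbs_nonneg)
      also have "\<dots> = 1" using H by (simp add: sum_gibbs)
      also have "1 \<le> 1 / m * q h\<^sub>0 \<omega>" using False m by (simp add: field_simps)
      finally show ?thesis
        using sum_nonneg[of ?HB "\<lambda>h. exp (s * m) * exp (- s * q h \<omega>)"] by simp
    qed
    then have "ennreal (\<Sum>h\<in>?HB. ?g h)
        \<le> ennreal (1 / m * q h\<^sub>0 \<omega> + (\<Sum>h\<in>?HB. exp (s * m) * exp (- s * q h \<omega>)))"
      by (rule ennreal_leI)
    also have "\<dots> = ennreal (1 / m) * ennreal (q h\<^sub>0 \<omega>)
        + (\<Sum>h\<in>?HB. ennreal (exp (s * m)) * ennreal (exp (- s * q h \<omega>)))"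
    proof -
      have "0 \<le> 1 / m * q h\<^sub>0 \<omega>" using m q_nonneg by simp
      moreover have "0 \<le> (\<Sum>h\<in>?HB. exp (s * m) * exp (- s * q h \<omega>))" by (simp add: sum_nonneg)
      moreover have "ennreal (\<Sum>h\<in>?HB. exp (s * m) * exp (- s * q h \<omega>))
          = (\<Sum>h\<in>?HB. ennreal (exp (s * m) * exp (- s * q h \<omega>)))"
        by (rule sum_ennreal[symmetric]) simp
      moreover have "ennreal (1 / m * q h\<^sub>0 \<omega>) = ennreal (1 / m) * ennreal (q h\<^sub>0 \<omega>)"
        using m q_nonneg by (intro ennreal_mult) auto
      ultimately show ?thesis by (simp only: ennreal_plus ennreal_mult[OF exp_ge_zero exp_ge_zero])
    qed
    finally show ?thesis
      unfolding run_on_sample_def using H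
      by (subst emeasure_exponential_mechanism) (auto simp: q_def)
  qed
  \<comment> \<open>The pointwise bound is averaged over the sample; linearity then reduces
    everything to the two expectations already computed.\<close>
  have "emeasure (bind ?P ?R) ?B = (\<integral>\<^sup>+\<omega>. emeasure (?R \<omega>) ?B \<partial>?P)"
    using P.not_empty measurable_prob_algebraD[OF R]
    by (intro emeasure_bind[where N = "count_space (hypotheses d)"]) auto
  also have "\<dots> \<le> (\<integral>\<^sup>+\<omega>. ennreal (1 / m) * ennreal (q h\<^sub>0 \<omega>)
      + (\<Sum>h\<in>?HB. ennreal (exp (s * m)) * ennreal (exp (- s * q h \<omega>))) \<partial>?P)"
    by (intro nn_integral_mono pointwise)
  also have "\<dots> = ennreal (1 / m) * (\<integral>\<^sup>+\<omega>. ennreal (q h\<^sub>0 \<omega>) \<partial>?P)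
      + (\<Sum>h\<in>?HB. ennreal (exp (s * m)) * (\<integral>\<^sup>+\<omega>. ennreal (exp (- s * q h \<omega>)) \<partial>?P))"
  proof -
    have q' [measurable]: "q h \<in> borel_measurable ?P" if "h \<in> H" for h
      unfolding q_def using q[OF that] .
    have "(\<integral>\<^sup>+\<omega>. (\<Sum>h\<in>?HB. ennreal (exp (s * m)) * ennreal (exp (- s * q h \<omega>))) \<partial>?P)
        = (\<Sum>h\<in>?HB. \<integral>\<^sup>+\<omega>. ennreal (exp (s * m)) * ennreal (exp (- s * q h \<omega>)) \<partial>?P)"
      by (rule nn_integral_sum) simp
    also have "\<dots> = (\<Sum>h\<in>?HB. ennreal (exp (s * m)) * (\<integral>\<^sup>+\<omega>. ennreal (exp (- s * q h \<omega>)) \<partial>?P))"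
      by (intro sum.cong refl nn_integral_cmult) simp
    finally show ?thesis
      using h\<^sub>0(1) by (subst nn_integral_add) (simp_all add: nn_integral_cmult)
  qed
  also have "\<dots> \<le> ennreal (1 / m) * ennreal (real n * \<beta>)
      + (\<Sum>h\<in>?HB. ennreal (exp (s * m)) * ennreal (exp (- real n * \<alpha> * (1 - exp (- s)))))"
    unfolding q_def
    using nn_integral_error_count[OF D h\<^sub>0(1)] nn_integral_exp_error_count[OF D _ s bad] h\<^sub>0(2)
    by (intro add_mono mult_left_mono sum_mono) (auto intro!: ennreal_leI mult_left_mono)
  also have "\<dots> \<le> ennreal (1 / m) * ennreal (real n * \<beta>)
      + (\<Sum>h\<in>H. ennreal (exp (s * m)) * ennreal (exp (- real n * \<alpha> * (1 - exp (- s)))))"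
    using H by (intro add_left_mono sum_mono2) auto
  also have "\<dots> = ennreal (real n * \<beta> / m + real (card H) * exp (s * m - real n * \<alpha> * (1 - exp (- s))))"
  proof -
    have \<beta>: "0 \<le> \<beta>" using h\<^sub>0(2) by (rule order_trans[rotated]) (simp add: robust_risk_def)
    have "ennreal (1 / m) * ennreal (real n * \<beta>) = ennreal (real n * \<beta> / m)"
      using m \<beta> by (simp flip: ennreal_mult)
    moreover have "ennreal (exp (s * m)) * ennreal (exp (- real n * \<alpha> * (1 - exp (- s))))
        = ennreal (exp (s * m - real n * \<alpha> * (1 - exp (- s))))"
      by (simp flip: ennreal_mult exp_add)
    moreover have "(\<Sum>h\<in>H. ennreal c) = ennreal (real (card H) * c)" if "0 \<le> c" for c
      using that by (simp add: ennreal_of_nat_eq_real_of_nat ennreal_mult)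
    ultimately show ?thesis using m \<beta> by (simp flip: ennreal_plus)
  qed
  finally show ?thesis .
qed

text \<open>Realizability at radius \<open>\<gamma>\<^sub>0\<close> enters through
  \<open>good\<close>, which supplies the competitor \<open>h\<^sub>0\<close> of small risk at
  radius \<open>\<gamma>\<close>. The failure bound becomes the guarantee by taking
  complements.\<close>

lemma robust_learner_exponential_mechanism:
  assumes s: "0 \<le> s" and m: "0 < m"
    and good: "\<And>D. example_distribution d D \<Longrightarrow> realizable d \<gamma>\<^sub>0 D \<Longrightarrow> \<exists>h\<in>H. robust_risk d \<gamma> h D \<le> \<beta>"
    and \<xi>: "real n * \<beta> / m + real (card H) * exp (s * m - real n * \<alpha> * (1 - exp (- s))) \<le> \<xi>"
    and "0 \<le> \<xi>"
  shows "robust_learner d \<gamma>\<^sub>0 \<gamma> \<alpha> \<xi> n (exponential_mechanism d \<gamma> s H)"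
  unfolding robust_learner_def
proof (intro conjI allI impI)
  show "randomized_algorithm d (exponential_mechanism d \<gamma> s H)"
    using H by (simp add: randomized_algorithm_def sets_exponential_mechanism
        prob_space_exponential_mechanism)
  show R: "run_on_sample n (exponential_mechanism d \<gamma> s H)
      \<in> (\<Pi>\<^sub>M i\<in>{..<n}. example_space d) \<rightarrow>\<^sub>M prob_algebra (count_space (hypotheses d))"
    by (rule run_exponential_mechanism_measurable)
  fix D assume D: "example_distribution d D" and real: "realizable d \<gamma>\<^sub>0 D"
  obtain h\<^sub>0 where h\<^sub>0: "h\<^sub>0 \<in> H" "robust_risk d \<gamma> h\<^sub>0 D \<le> \<beta>" using good[OF D real] by auto
  let ?G = "{h \<in> hypotheses d. robust_error d \<gamma> h \<in> sets D \<and> robust_risk d \<gamma> h D \<le> \<alpha>}"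
  let ?L = "bind (\<Pi>\<^sub>M i\<in>{..<n}. D) (run_on_sample n (exponential_mechanism d \<gamma> s H))"
  have "sets (\<Pi>\<^sub>M i\<in>{..<n}. D) = sets (\<Pi>\<^sub>M i\<in>{..<n}. example_space d)"
    by (intro sets_PiM_cong) (auto simp: example_distributionD[OF D])
  then have "(\<Pi>\<^sub>M i\<in>{..<n}. D) \<in> space (prob_algebra (\<Pi>\<^sub>M i\<in>{..<n}. example_space d))"
    by (auto simp: space_prob_algebra intro!: prob_space_PiM example_distributionD[OF D])
  then have L: "prob_space ?L" "sets ?L = sets (count_space (hypotheses d))"
    using R by (rule prob_space_bind', rule sets_bind')
  then have L': "space ?L = hypotheses d"
    using sets_eq_imp_space_eq[OF L(2)] by simp
  interpret L: prob_space ?L by fact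
  have "ennreal (measure ?L (hypotheses d - ?G)) \<le> ennreal \<xi>"
    using exponential_mechanism_failure[OF D s h\<^sub>0 m, of \<alpha>] ennreal_leI[OF \<xi>]
    by (simp add: L.emeasure_eq_measure)
  then have "measure ?L (hypotheses d - ?G) \<le> \<xi>" using \<open>0 \<le> \<xi>\<close> by simp
  moreover have "measure ?L (hypotheses d - ?G) = 1 - measure ?L ?G"
    using L.prob_compl[of ?G] by (simp add: L L')
  ultimately show "1 - \<xi> \<le> measure ?L ?G" by simp
qed

end

section \<open>Learning with integer halfspaces\<close>

definition integer_halfspace :: "nat \<Rightarrow> (nat \<Rightarrow> int) \<Rightarrow> hypothesis" where
  "integer_halfspace d v = halfspace d (\<lambda>i. of_int (v i))"

lemma halfspace_hypotheses: "halfspace d w \<in> hypotheses d"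
  by (auto simp: halfspace_def hypotheses_def sign_def labels_def)

lemma halfspace_cong: "(\<And>i. i < d \<Longrightarrow> w i = w' i) \<Longrightarrow> halfspace d w = halfspace d w'"
  by (simp add: halfspace_def inner_d_def)

lemma halfspace_norm_d_eq_0:
  assumes "norm_d d w = 0" "norm_d d w' = 0"
  shows "halfspace d w = halfspace d w'"
  using assms by (simp add: halfspace_def norm_d_eq_0_inner)

lemma norm_d_le_sqrt:
  assumes "\<And>i. i < d \<Longrightarrow> \<bar>e i\<bar> \<le> 1"
  shows "norm_d d e \<le> sqrt (real d)"
proof -
  have "(\<Sum>i<d. (e i)\<^sup>2) \<le> (\<Sum>i<d. 1)"
    using assms by (intro sum_mono) (simp add: abs_square_le_1)
  then show ?thesis by (simp add: norm_d_def L2_set_def)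
qed

lemma robust_error_mono: "\<gamma>' \<le> \<gamma> \<Longrightarrow> robust_error d \<gamma>' h \<subseteq> robust_error d \<gamma> h"
  unfolding robust_error_def by (auto intro: order_trans)

text \<open>The three conditions on \<open>T\<close> make the rounding change the norm by at most
  one percent, keep the scaled margin \<open>T * \<gamma>\<close> large against the tolerated
  deviation \<open>t\<close>, and place the rounded vector in the integer ball.\<close>

lemma exists_good_integer_halfspace:
  assumes D: "example_distribution d D" "realizable d \<gamma> D"
    and \<gamma>: "0 < \<gamma>" "\<gamma> \<le> 1" and t: "0 < t"
    and T: "100 * sqrt (real d) \<le> T" "12 * t \<le> T * \<gamma>" "(T + sqrt (real d))\<^sup>2 \<le> real M"
  shows "\<exists>v\<in>integer_ball d M. robust_risk d (9 / 10 * \<gamma>) (integer_halfspace d v) D \<le> 1 / t\<^sup>2"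
proof -
  note DD = example_distributionD[OF D(1)]
  interpret D: prob_space D by (rule DD(1))
  obtain w where w: "robust_risk d \<gamma> (halfspace d w) D = 0"
    using D(2) by (auto simp: realizable_def)
  have sets: "robust_error d \<gamma> (halfspace d u) \<in> sets D" for u
    using robust_error_halfspace_sets \<gamma> DD(2) by simp
  show ?thesis
  proof (cases "norm_d d w = 0")
    case True
    \<comment> \<open>A null target has no direction to scale; the zero vector gives the same
      constant classifier, and shrinking the radius keeps its risk zero.\<close>
    define v :: "nat \<Rightarrow> int" where "v = (\<lambda>i\<in>{..<d}. 0)"
    have "norm_d d (\<lambda>i. of_int (v i)) = 0"
      by (simp add: norm_d_def v_def L2_set_def)
    then have "integer_halfspace d v = halfspace d w"
      unfolding integer_halfspace_def using True by (rule halfspace_norm_d_eq_0)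
    moreover have "measure D (robust_error d (9 / 10 * \<gamma>) (halfspace d w))
        \<le> measure D (robust_error d \<gamma> (halfspace d w))"
      using \<gamma> sets[of w] by (intro D.finite_measure_mono robust_error_mono) auto
    ultimately have "robust_risk d (9 / 10 * \<gamma>) (integer_halfspace d v) D \<le> 0"
      using w by (simp add: robust_risk_def)
    moreover have "v \<in> integer_ball d M" by (simp add: integer_ball_def v_def)
    ultimately show ?thesis
      by (intro bexI[of _ v]) (auto intro: order_trans)
  next
    case False
    then have nw: "0 < norm_d d w" using norm_d_nonneg[of d w] by linarith
    have T0: "0 \<le> T" using T(1) by (rule order_trans[rotated]) simp
    define a where "a = (\<lambda>i. (T / norm_d d w) * w i)"
    obtain v :: "nat \<Rightarrow> int" where v: "\<And>i. i < d \<Longrightarrow> \<bar>of_int (v i) - a i\<bar> \<le> 1"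
      and prob: "measure D {p \<in> space D. t \<le> \<bar>inner_d d (\<lambda>i. of_int (v i) - a i) (fst p)\<bar>} \<le> 1 / t\<^sup>2"
      using exists_integer_direction[OF D(1) t, of a] by blast
    define e where "e = (\<lambda>i. of_int (v i) - a i)"
    define u where "u = (\<lambda>i. real_of_int (v i))"
    define v' where "v' = restrict v {..<d}"
    have u: "u = (\<lambda>i. a i + e i)" by (simp add: u_def e_def)
    have "norm_d d a = T"
      unfolding a_def norm_d_scale using nw T0 by simp
    then have nu: "norm_d d u \<le> T + sqrt (real d)"
      unfolding u using norm_d_add[of d a e] norm_d_le_sqrt[of d e] v by (simp add: e_def)
    have v'u: "integer_halfspace d v' = halfspace d u"
      unfolding integer_halfspace_def u_def v'_def by (rule halfspace_cong) simp
    have "real_of_int (\<Sum>i<d. (v' i)\<^sup>2) = (norm_d d u)\<^sup>2"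
      by (subst inner_d_self[symmetric]) (simp add: inner_d_def u_def v'_def power2_eq_square)
    also have "\<dots> \<le> (T + sqrt (real d))\<^sup>2"
      using nu by (intro power_mono) auto
    also have "\<dots> \<le> real M" by (rule T)
    finally have "(\<Sum>i<d. (v' i)\<^sup>2) \<le> int M" by linarith
    then have ball: "v' \<in> integer_ball d M"
      by (simp add: integer_ball_def v'_def)
    have [measurable]: "(\<lambda>p. inner_d d e (fst p)) \<in> borel_measurable D"
      using inner_d_fst_measurable[of d e] by (simp add: DD(4))
    let ?F = "{p \<in> space D. t \<le> \<bar>inner_d d e (fst p)\<bar>}"
    have F: "?F \<in> sets D" by measurable
    \<comment> \<open>Here \<open>0.9 * 1.01 = 0.909\<close>, and the remaining
      \<open>0.091 * T * \<gamma>\<close> is at least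
      \<open>0.091 * 12 * t = 1.092 * t\<close>.\<close>
    have margin: "9 / 10 * \<gamma> * norm_d d u + t \<le> T * \<gamma>"
    proof -
      have "9 / 10 * \<gamma> * norm_d d u \<le> 9 / 10 * \<gamma> * (T + T / 100)"
        using nu T(1) \<gamma> by (intro mult_left_mono) auto
      then show ?thesis using T(2) t by (simp add: algebra_simps)
    qed
    \<comment> \<open>Where the target has margin \<open>\<gamma>\<close>, the scaled target
      \<open>a\<close> has margin \<open>T * \<gamma>\<close>; by \<open>margin\<close>, an error of
      \<open>u\<close> then forces a rounding deviation of at least \<open>t\<close>. The first set
      of the union is null.\<close>
    have "robust_error d (9 / 10 * \<gamma>) (halfspace d u) \<subseteq> robust_error d \<gamma> (halfspace d w) \<union> ?F"
    proof
      fix p assume p: "p \<in> robust_error d (9 / 10 * \<gamma>) (halfspace d u)"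
      obtain x y where xy: "p = (x, y)" by (cases p)
      have in_space: "x \<in> unit_ball d" "y \<in> labels"
        and err: "y = 1 \<Longrightarrow> inner_d d u x < 9 / 10 * \<gamma> * norm_d d u"
          "y \<noteq> 1 \<Longrightarrow> inner_d d u x \<ge> - (9 / 10 * \<gamma> * norm_d d u)"
        using p \<gamma> by (auto simp: xy robust_error_halfspace)
      have ux: "inner_d d u x = T / norm_d d w * inner_d d w x + inner_d d e x"
        unfolding u inner_d_add_left a_def inner_d_scale_left ..
      show "p \<in> robust_error d \<gamma> (halfspace d w) \<union> ?F"
      proof (cases "p \<in> robust_error d \<gamma> (halfspace d w)")
        case False
        have "t \<le> \<bar>inner_d d e x\<bar>"
        proof (cases "y = 1")
          case True
          have "\<gamma> * norm_d d w \<le> inner_d d w x"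
            using False True in_space \<gamma> by (auto simp: xy robust_error_halfspace)
          then have "T / norm_d d w * (\<gamma> * norm_d d w) \<le> T / norm_d d w * inner_d d w x"
            using T0 nw by (intro mult_left_mono) auto
          then have "T * \<gamma> \<le> T / norm_d d w * inner_d d w x"
            using nw by simp
          then show ?thesis using err(1)[OF True] ux margin by linarith
        next
          case y: False
          have "inner_d d w x \<le> - (\<gamma> * norm_d d w)"
            using False y in_space \<gamma> by (auto simp: xy robust_error_halfspace)
          then have "T / norm_d d w * inner_d d w x \<le> T / norm_d d w * - (\<gamma> * norm_d d w)"
            using T0 nw by (intro mult_left_mono) auto
          then have "T / norm_d d w * inner_d d w x \<le> - (T * \<gamma>)"
            using nw by simp
          then show ?thesis using err(2)[OF y] ux margin by linarith
        qed
        then show ?thesis using in_space by (simp add: DD xy)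
      qed simp
    qed
    then have "measure D (robust_error d (9 / 10 * \<gamma>) (halfspace d u))
        \<le> measure D (robust_error d \<gamma> (halfspace d w) \<union> ?F)"
      using sets[of w] F by (intro D.finite_measure_mono) auto
    also have "\<dots> \<le> measure D (robust_error d \<gamma> (halfspace d w)) + measure D ?F"
      using sets[of w] F by (intro measure_Un_le) auto
    also have "\<dots> \<le> 1 / t\<^sup>2"
      using w prob by (simp add: robust_risk_def e_def)
    finally show ?thesis
      using ball by (intro bexI[of _ v']) (auto simp: robust_risk_def v'u)
  qed
qed

text \<open>From \<open>1 + s \<le> exp s\<close>. For \<open>s \<le> C\<close> it gives the linear
  bound \<open>s / (1 + C)\<close>, which is how \<open>C\<close> enters the constants.\<close>

lemma one_minus_exp_ge:
  fixes s :: real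
  assumes "0 \<le> s"
  shows "s / (1 + s) \<le> 1 - exp (- s)"
proof -
  have "exp (- s) \<le> 1 / (1 + s)"
    using assms exp_ge_add_one_self[of s] by (simp add: exp_minus field_simps)
  moreover have "s / (1 + s) = 1 - 1 / (1 + s)" using assms by (simp add: field_simps)
  ultimately show ?thesis by simp
qed

text \<open>The failure probability is split into two halves \<open>\<xi> / 2\<close>. The condition
  on \<open>t\<close> controls the Markov term of the good hypothesis; the condition on
  \<open>n\<close> makes the exponent beat the logarithm of the class size.\<close>

lemma private_robust_halfspace_learner:
  fixes C \<xi> \<gamma> \<alpha> \<epsilon> t T :: real and d n M :: nat
  assumes C: "0 < C" and \<xi>: "0 < \<xi>" and \<gamma>: "0 < \<gamma>" "\<gamma> \<le> 1" and \<alpha>: "0 < \<alpha>" and \<epsilon>: "0 < \<epsilon>" "\<epsilon> \<le> C"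
    and t: "0 < t" "4 * (1 + C) \<le> \<xi> * \<alpha> * t\<^sup>2"
    and T: "100 * sqrt (real d) \<le> T" "12 * t \<le> T * \<gamma>" "(T + sqrt (real d))\<^sup>2 \<le> real M"
    and n: "4 * (1 + C) * (real M + 2 * real d + 2 / \<xi>) \<le> \<alpha> * \<epsilon> * real n"
  shows "\<exists>A. differentially_private d \<epsilon> 0 A \<and> robust_learner d \<gamma> (9 / 10 * \<gamma>) \<alpha> \<xi> n A"
proof -
  define H where "H = integer_halfspace d ` integer_ball d M"
  \<comment> \<open>Halved because the mechanism is private at level \<open>2 * s\<close>.\<close>
  define s where "s = \<epsilon> / 2"
  \<comment> \<open>Then \<open>s * m\<close> is half of the lower bound
    \<open>real n * \<alpha> * (s / (1 + C))\<close> on the exponential gain, and the other half is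
    left to pay for the class.\<close>
  define m where "m = real n * \<alpha> / (2 * (1 + C))"
  have H: "finite H" "H \<noteq> {}" "H \<subseteq> hypotheses d"
  proof -
    have "(\<lambda>i\<in>{..<d}. 0) \<in> integer_ball d M" by (simp add: integer_ball_def)
    then show "H \<noteq> {}" by (auto simp: H_def)
  qed (auto simp: H_def finite_integer_ball integer_halfspace_def halfspace_hypotheses)
  have meas: "robust_error d (9 / 10 * \<gamma>) h \<in> sets (example_space d)" if "h \<in> H" for h
    using that \<gamma> by (auto simp: H_def integer_halfspace_def intro!: robust_error_halfspace_sets)
  have s: "0 < s" "s \<le> C" using \<epsilon> C by (auto simp: s_def)
  have "0 < 4 * (1 + C) * (real M + 2 * real d + 2 / \<xi>)"
    using C \<xi> by (intro mult_pos_pos add_nonneg_pos) auto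
  then have "0 < \<alpha> * \<epsilon> * real n" using n by linarith
  then have n0: "0 < real n" using \<alpha> \<epsilon> by (simp add: zero_less_mult_iff)
  have m: "0 < m" using n0 \<alpha> C by (simp add: m_def)
  have good: "\<exists>h\<in>H. robust_risk d (9 / 10 * \<gamma>) h D \<le> 1 / t\<^sup>2"
    if "example_distribution d D" "realizable d \<gamma> D" for D
    using exists_good_integer_halfspace[OF that \<gamma> t(1) T] by (auto simp: H_def)
  have "real n * (1 / t\<^sup>2) / m = 2 * (1 + C) / (\<alpha> * t\<^sup>2)"
    using n0 by (simp add: m_def)
  also have "\<dots> \<le> \<xi> / 2"
    using t \<alpha> by (simp add: divide_le_eq mult_ac)
  finally have "real n * (1 / t\<^sup>2) / m \<le> \<xi> / 2" .
  moreover have "real (card H) * exp (s * m - real n * \<alpha> * (1 - exp (- s))) \<le> \<xi> / 2"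
  proof -
    have "s / (1 + C) \<le> s / (1 + s)" using s by (intro divide_left_mono) auto
    also have "\<dots> \<le> 1 - exp (- s)" using s by (intro one_minus_exp_ge) auto
    finally have "real n * \<alpha> * (s / (1 + C)) \<le> real n * \<alpha> * (1 - exp (- s))"
      using n0 \<alpha> by (intro mult_left_mono) auto
    moreover have "real n * \<alpha> * (s / (1 + C)) = 2 * (s * m)"
      using C by (simp add: m_def field_simps)
    moreover have "real M + 2 * real d + 2 / \<xi> \<le> s * m"
      using n C by (simp add: m_def s_def field_simps)
    ultimately have "exp (s * m - real n * \<alpha> * (1 - exp (- s))) \<le> exp (- (real M + 2 * real d + 2 / \<xi>))"
      by simp
    moreover have "real (card H) \<le> exp (real M + 2 * real d)"
    proof -
      have "real (card H) \<le> real (card (integer_ball d M))"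
        unfolding H_def by (simp add: card_image_le finite_integer_ball)
      also have "\<dots> \<le> 2 ^ M * 3 ^ d" by (rule card_integer_ball_le)
      \<comment> \<open>By \<open>2 \<le> exp 1\<close> and \<open>3 \<le> exp 2\<close>, both
        instances of \<open>1 + x \<le> exp x\<close>.\<close>
      also have "\<dots> \<le> exp 1 ^ M * exp 2 ^ d"
        using exp_ge_add_one_self[of 1] exp_ge_add_one_self[of 2]
        by (intro mult_mono power_mono) auto
      also have "\<dots> = exp (real M + 2 * real d)"
        by (simp add: exp_add exp_of_nat_mult[symmetric] mult.commute)
      finally show ?thesis .
    qed
    ultimately have "real (card H) * exp (s * m - real n * \<alpha> * (1 - exp (- s)))
        \<le> exp (real M + 2 * real d) * exp (- (real M + 2 * real d + 2 / \<xi>))"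
      by (intro mult_mono) auto
    also have "\<dots> = exp (- (2 / \<xi>))" by (simp flip: exp_add)
    also have "\<dots> \<le> \<xi> / 2"
    proof -
      have "2 / \<xi> \<le> exp (2 / \<xi>)" using exp_ge_add_one_self[of "2 / \<xi>"] by linarith
      then show ?thesis using \<xi> by (simp add: exp_minus field_simps)
    qed
    finally show ?thesis .
  qed
  ultimately have fail: "real n * (1 / t\<^sup>2) / m
      + real (card H) * exp (s * m - real n * \<alpha> * (1 - exp (- s))) \<le> \<xi>"
    by linarith
  have "robust_learner d \<gamma> (9 / 10 * \<gamma>) \<alpha> \<xi> n (exponential_mechanism d (9 / 10 * \<gamma>) s H)"
    using H meas s m good fail \<xi> by (intro robust_learner_exponential_mechanism[where m = m]) auto
  moreover have "differentially_private d (2 * s) 0 (exponential_mechanism d (9 / 10 * \<gamma>) s H)"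
    using H s by (intro differentially_private_exponential_mechanism) auto
  ultimately show ?thesis by (auto simp: s_def)
qed

text \<open>Absorbs the actual dependence \<open>1 / \<alpha>\<^sup>2\<close> into the power allowed
  by the theorem.\<close>

lemma inverse_square_le_powr:
  fixes x K :: real
  assumes "0 < x" "x \<le> 1" "2 \<le> K"
  shows "1 / x\<^sup>2 \<le> x powr (- K)"
proof -
  have "1 / x\<^sup>2 = x powr (- 2)"
    using assms by (simp add: powr_minus divide_inverse)
  also have "\<dots> \<le> x powr (- K)"
    using assms by (intro powr_mono') auto
  finally show ?thesis .
qed

theorem theorem5:
  shows "\<exists>c\<^sub>0::real. 0 < c\<^sub>0 \<and> c\<^sub>0 < 1 \<and>
    (\<forall>(C::real) (\<xi>::real). C > 0 \<longrightarrow> 0 < \<xi> \<longrightarrow> \<xi> \<le> c\<^sub>0 \<longrightarrow>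
      (\<exists>K::real. K > 0 \<and>
        (\<forall>(d::nat) (\<gamma>::real) (\<alpha>::real) (\<epsilon>::real).
          d \<ge> 1 \<longrightarrow> 0 < \<gamma> \<longrightarrow> \<gamma> \<le> c\<^sub>0 \<longrightarrow> 0 < \<alpha> \<longrightarrow> \<alpha> \<le> c\<^sub>0 \<longrightarrow> 0 < \<epsilon> \<longrightarrow> \<epsilon> \<le> C \<longrightarrow>
          (\<exists>(n::nat) (A::learner).
            real n \<le> K * \<alpha> powr (- K) * (1 / \<epsilon>) * max (real d) (1 / \<gamma>\<^sup>2) \<and>
            differentially_private d \<epsilon> 0 A \<and>
            robust_learner d \<gamma> (9 / 10 * \<gamma>) \<alpha> \<xi> n A))))"
proof (rule exI[of _ "1 / 2 :: real"], intro conjI allI impI)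
  fix C \<xi> :: real assume C: "C > 0" and \<xi>: "0 < \<xi>" "\<xi> \<le> 1 / 2"
  \<comment> \<open>The number is \<open>2 * 4 * 20695 * 4\<close>: a factor 2 from rounding
    \<open>L\<close> up, \<open>4 * (1 + C)\<close> from the condition on \<open>n\<close>, 20695
    from the class size, and \<open>4 * (1 + C)\<close> from \<open>b\<close>. Adding 2 ensures
    \<open>2 \<le> K\<close>.\<close>
  define K where "K = 662240 * ((1 + C)\<^sup>2 / \<xi>) + 2"
  have K2: "K \<ge> 2" using \<xi> by (simp add: K_def)
  have "\<exists>n A. real n \<le> K * \<alpha> powr (- K) * (1 / \<epsilon>) * max (real d) (1 / \<gamma>\<^sup>2) \<and>
      differentially_private d \<epsilon> 0 A \<and> robust_learner d \<gamma> (9 / 10 * \<gamma>) \<alpha> \<xi> n A"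
    if d: "d \<ge> 1" and \<gamma>: "0 < \<gamma>" "\<gamma> \<le> 1 / 2" and \<alpha>: "0 < \<alpha>" "\<alpha> \<le> 1 / 2" and \<epsilon>: "0 < \<epsilon>" "\<epsilon> \<le> C"
    for d :: nat and \<gamma> \<alpha> \<epsilon> :: real
  proof -
    define \<mu> where "\<mu> = max (real d) (1 / \<gamma>\<^sup>2)"
    define b where "b = 4 * (1 + C) / (\<xi> * \<alpha>)"
    define t where "t = sqrt b"
    \<comment> \<open>The sum meets both lower bounds on \<open>T\<close>, and its square is of
      order \<open>d + b / \<gamma>\<^sup>2\<close>, hence of order
      \<open>b * \<mu>\<close>.\<close>
    define T where "T = 100 * sqrt (real d) + 12 * t / \<gamma>"
    define M where "M = nat \<lceil>(T + sqrt (real d))\<^sup>2\<rceil>"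
    define L where "L = 4 * (1 + C) / (\<alpha> * \<epsilon>) * (real M + 2 * real d + 2 / \<xi>)"
    define n where "n = nat \<lceil>L\<rceil>"
    have \<mu>: "1 \<le> \<mu>" "real d \<le> \<mu>" "1 / \<gamma>\<^sup>2 \<le> \<mu>" using d by (auto simp: \<mu>_def)
    have b: "1 / \<xi> \<le> b" "1 \<le> b"
    proof -
      have "\<alpha> \<le> 4 * (1 + C)" using \<alpha> C by simp
      then show "1 / \<xi> \<le> b" using \<xi> \<alpha> by (simp add: b_def field_simps)
      moreover have "1 \<le> 1 / \<xi>" using \<xi> by simp
      ultimately show "1 \<le> b" by linarith
    qed
    have t: "0 < t" "t\<^sup>2 = b" using b by (auto simp: t_def)
    have T: "100 * sqrt (real d) \<le> T" "12 * t \<le> T * \<gamma>"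
      using \<gamma> t by (auto simp: T_def field_simps)
    \<comment> \<open>Every contribution to the sample size, including the rounding and
      \<open>2 / \<xi>\<close>, is dominated by the single quantity
      \<open>b * \<mu>\<close>.\<close>
    have b\<mu>: "1 \<le> b * \<mu>" "real d \<le> b * \<mu>" "b / \<gamma>\<^sup>2 \<le> b * \<mu>" "2 / \<xi> \<le> 2 * (b * \<mu>)"
    proof -
      show "1 \<le> b * \<mu>" using mult_mono[of 1 b 1 \<mu>] b \<mu> by simp
      show "real d \<le> b * \<mu>" using mult_mono[of 1 b "real d" \<mu>] b \<mu> by simp
      show "b / \<gamma>\<^sup>2 \<le> b * \<mu>" using mult_left_mono[OF \<mu>(3), of b] b by simp
      show "2 / \<xi> \<le> 2 * (b * \<mu>)" using mult_mono[of "1 / \<xi>" b 1 \<mu>] b \<mu> by simp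
    qed
    \<comment> \<open>The constants are \<open>2 * 101\<^sup>2 = 20402\<close> and
      \<open>2 * 12\<^sup>2 = 288\<close>. One more \<open>b * \<mu>\<close> pays for the ceiling in
      \<open>M\<close>, and four more for \<open>2 * real d\<close> and \<open>2 / \<xi>\<close>,
      giving 20695.\<close>
    have "(T + sqrt (real d))\<^sup>2 = (101 * sqrt (real d) + 12 * t / \<gamma>)\<^sup>2"
      by (simp add: T_def)
    also have "\<dots> \<le> 2 * (101 * sqrt (real d))\<^sup>2 + 2 * (12 * t / \<gamma>)\<^sup>2"
      using sum_squares_bound[of "101 * sqrt (real d)" "12 * t / \<gamma>"] by (simp add: power2_sum)
    also have "\<dots> = 20402 * real d + 288 * (b / \<gamma>\<^sup>2)"
      by (simp add: power_mult_distrib power_divide t(2))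
    also have "\<dots> \<le> 20690 * (b * \<mu>)" using b\<mu> by linarith
    finally have "real M \<le> 20691 * (b * \<mu>)" using b\<mu>(1) unfolding M_def by linarith
    then have \<Lambda>: "real M + 2 * real d + 2 / \<xi> \<le> 20695 * (b * \<mu>)"
      using b\<mu> by linarith
    \<comment> \<open>Ensures that rounding \<open>L\<close> up to an integer at most doubles
      it.\<close>
    have L1: "1 \<le> L"
    proof -
      have "\<alpha> * \<epsilon> \<le> 1 * C" using \<alpha> \<epsilon> by (intro mult_mono) auto
      then have "1 \<le> 4 * (1 + C) / (\<alpha> * \<epsilon>)" using C \<alpha> \<epsilon> by (simp add: field_simps)
      moreover have "1 \<le> real d" "0 \<le> 2 / \<xi>" "0 \<le> real M" using d \<xi> by auto
      then have "1 \<le> real M + 2 * real d + 2 / \<xi>" by linarith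
      ultimately show ?thesis
        unfolding L_def using mult_mono[of 1 "4 * (1 + C) / (\<alpha> * \<epsilon>)" 1] by simp
    qed
    then have nL: "real n \<le> 2 * L" "L \<le> real n" by (auto simp: n_def, linarith+)
    have "L \<le> 4 * (1 + C) / (\<alpha> * \<epsilon>) * (20695 * (b * \<mu>))"
      unfolding L_def using \<Lambda> C \<alpha> \<epsilon> by (intro mult_left_mono) auto
    then have "real n \<le> 2 * (4 * (1 + C) / (\<alpha> * \<epsilon>) * (20695 * (b * \<mu>)))" using nL by linarith
    also have "\<dots> = (662240 * ((1 + C)\<^sup>2 / \<xi>)) * (1 / \<alpha>\<^sup>2) * (1 / \<epsilon>) * \<mu>"
    proof -
      \<comment> \<open>With \<open>1 + C\<close> abstracted to \<open>D\<close> both sides are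
        monomials.\<close>
      have "2 * (4 * D / (\<alpha> * \<epsilon>) * (20695 * (4 * D / (\<xi> * \<alpha>) * \<mu>)))
          = (662240 * (D\<^sup>2 / \<xi>)) * (1 / \<alpha>\<^sup>2) * (1 / \<epsilon>) * \<mu>" for D
        by (simp add: power2_eq_square mult_ac)
      then show ?thesis unfolding b_def .
    qed
    also have "\<dots> \<le> K * \<alpha> powr (- K) * (1 / \<epsilon>) * \<mu>"
    proof (intro mult_right_mono mult_mono)
      show "662240 * ((1 + C)\<^sup>2 / \<xi>) \<le> K"
        unfolding K_def by simp
      show "1 / \<alpha>\<^sup>2 \<le> \<alpha> powr (- K)"
        using \<alpha> K2 by (intro inverse_square_le_powr) auto
    qed (use K2 \<epsilon> \<mu> in auto)
    finally have bound: "real n \<le> K * \<alpha> powr (- K) * (1 / \<epsilon>) * \<mu>" .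
    have "\<exists>A. differentially_private d \<epsilon> 0 A \<and> robust_learner d \<gamma> (9 / 10 * \<gamma>) \<alpha> \<xi> n A"
    proof (rule private_robust_halfspace_learner[where C = C and t = t and T = T and M = M])
      show "4 * (1 + C) \<le> \<xi> * \<alpha> * t\<^sup>2" using \<xi> \<alpha> by (simp add: t(2) b_def)
      show "(T + sqrt (real d))\<^sup>2 \<le> real M" unfolding M_def by linarith
      show "4 * (1 + C) * (real M + 2 * real d + 2 / \<xi>) \<le> \<alpha> * \<epsilon> * real n"
      proof -
        have "4 * (1 + C) * (real M + 2 * real d + 2 / \<xi>) = \<alpha> * \<epsilon> * L"
          using \<alpha> \<epsilon> by (simp add: L_def)
        also have "\<dots> \<le> \<alpha> * \<epsilon> * real n"
          using nL(2) \<alpha> \<epsilon> by (intro mult_left_mono) auto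
        finally show ?thesis .
      qed
    qed (use C \<xi> \<gamma> \<alpha> \<epsilon> t T in auto)
    then show ?thesis using bound unfolding \<mu>_def by blast
  qed
  then show "\<exists>K>0. \<forall>(d::nat) (\<gamma>::real) (\<alpha>::real) (\<epsilon>::real).
      d \<ge> 1 \<longrightarrow> 0 < \<gamma> \<longrightarrow> \<gamma> \<le> 1 / 2 \<longrightarrow> 0 < \<alpha> \<longrightarrow> \<alpha> \<le> 1 / 2 \<longrightarrow> 0 < \<epsilon> \<longrightarrow> \<epsilon> \<le> C \<longrightarrow>
      (\<exists>(n::nat) (A::learner).
        real n \<le> K * \<alpha> powr (- K) * (1 / \<epsilon>) * max (real d) (1 / \<gamma>\<^sup>2) \<and>
        differentially_private d \<epsilon> 0 A \<and> robust_learner d \<gamma> (9 / 10 * \<gamma>) \<alpha> \<xi> n A)"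
    using K2 by (intro exI[of _ K]) auto
qed auto

end
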